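(* Let $(G,F)$ be a framed graph and $C,C'$ maximal cliques. Then $C\le C'$ in the framing poset $\mathscr L_{G,F}$ if and only if $C$ is cw from $C'$, i.e. for all routes $R\in C$, $R'\in C'$ and every common inner vertex $v$ of $R$ and $R'$, either $R$ and $R'$ are coherent at $v$ or $R<_v^{cw}R'$.
   Context: A flow graph $G$ is a finite directed acyclic multigraph with linearly ordered vertices, edges directed from smaller to larger vertices, a unique source $s$ and unique sink $t$; a route is a directed $s$–$t$ path. A framing $F$ gives at each vertex $v$ linear orders $\le_{\mathrm{In}(v)}$, $\le_{\mathrm{Out}(v)}$ on entering and leaving edges. For a path $P$ through $v$, $Pv$ (resp. $vP$) is the maximal subpath of $P$ ending (resp. starting) at $v$. For $Pv,Qv$, let $w$ be the first vertex after which they coincide; if $w$ is the first vertex of one of them they are equal, else $Pv<_{\mathscr I(v)}Qv$ iff $P$'s edge entering $w$ precedes $Q$'s in $\le_{\mathrm{In}(w)}$. Dually for $vP,vQ$ with $w'$ the last vertex before which they coincide, using $\le_{\mathrm{Out}(w')}$, giving $<_{\mathscr O(v)}$. For paths $P,Q$ with common inner vertex $v$ (neither first nor last vertex), $P<_v^{cw}Q$ means $Pv<_{\mathscr I(v)}Qv$ and $vQ<_{\mathscr O(v)}vP$; they are incoherent at $v$ if $P<_v^{cw}Q$ or $Q<_v^{cw}P$, coherent if incoherent at no common inner vertex. A clique is a set of pairwise coherent routes. For maximal cliques, $C\lessdot C'$ if $C'=(C\setminus\{R\})\cup\{R'\}$ with $R<_u^{cw}R'$ for some $u$; the framing poset $\mathscr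 L_{G,F}$ is the set of maximal cliques ordered by the reflexive-transitive closure $\le$ of $\lessdot$. *)

theory Defs
  imports "Graph_Theory.Digraph" "Graph_Theory.Arc_Walk"
begin

locale flow_graph = fin_digraph G for G :: "('v::linorder, 'e) pre_digraph" +
  fixes s t :: 'v
  assumes arcs_increasing: "e \<in> arcs G \<Longrightarrow> tail G e < head G e"
    and unique_source: "{v \<in> verts G. in_arcs G v = {}} = {s}"
    and unique_sink: "{v \<in> verts G. out_arcs G v = {}} = {t}"

text \<open>The orders of a framing are kept as reflexive relations on arcs.\<close>

record ('v, 'e) framing =
  in_ord :: "'v \<Rightarrow> 'e rel"
  out_ord :: "'v \<Rightarrow> 'e rel"

locale framed_graph = flow_graph G s t
  for G :: "('v::linorder, 'e) pre_digraph" and s t :: 'v +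
  fixes F :: "('v, 'e) framing"
  assumes in_ord_linear: "v \<in> verts G \<Longrightarrow> linear_order_on (in_arcs G v) (in_ord F v)"
    and out_ord_linear: "v \<in> verts G \<Longrightarrow> linear_order_on (out_arcs G v) (out_ord F v)"

definition routes :: "('v, 'e) pre_digraph \<Rightarrow> 'v \<Rightarrow> 'v \<Rightarrow> 'e list set" where
  "routes G s t = {R. pre_digraph.apath G s R t}"

text \<open>Paths are lists of arcs; the empty list (a one-vertex path) has no inner vertex.\<close>

definition inner_verts :: "('v, 'e) pre_digraph \<Rightarrow> 'e list \<Rightarrow> 'v set" where
  "inner_verts G P =
     (tail G ` set P \<union> head G ` set P) - {tail G (hd P), head G (last P)}"

text \<open>The subpaths \<open>Pv\<close> and \<open>vP\<close>, for a path \<open>P\<close> through \<open>v\<close>: a path in an acyclic graph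
  visits \<open>v\<close> only once, so it splits in front of its arc leaving \<open>v\<close>.\<close>

definition path_to :: "('v, 'e) pre_digraph \<Rightarrow> 'e list \<Rightarrow> 'v \<Rightarrow> 'e list" where
  "path_to G P v = takeWhile (\<lambda>e. tail G e \<noteq> v) P"

definition path_from :: "('v, 'e) pre_digraph \<Rightarrow> 'v \<Rightarrow> 'e list \<Rightarrow> 'e list" where
  "path_from G v P = dropWhile (\<lambda>e. tail G e \<noteq> v) P"

text \<open>\<open>A\<close> and \<open>B\<close> stand for \<open>Pv\<close> and \<open>Qv\<close>. They coincide exactly from \<open>w\<close> on, along \<open>S\<close>,
  and enter \<open>w\<close> by the distinct arcs \<open>e\<close> and \<open>f\<close>. If \<open>w\<close> is the first vertex of \<open>A\<close> or \<open>B\<close>, no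
  such arcs exist and neither path is less than the other. Dually for \<open>out_less\<close>.\<close>

definition in_less ::
  "('v, 'e) pre_digraph \<Rightarrow> ('v, 'e) framing \<Rightarrow> 'e list \<Rightarrow> 'e list \<Rightarrow> bool" where
  "in_less G F A B \<longleftrightarrow> (\<exists>A' B' S e f w. A = A' @ e # S \<and> B = B' @ f # S \<and> e \<noteq> f \<and>
     head G e = w \<and> head G f = w \<and> (e, f) \<in> in_ord F w)"

definition out_less ::
  "('v, 'e) pre_digraph \<Rightarrow> ('v, 'e) framing \<Rightarrow> 'e list \<Rightarrow> 'e list \<Rightarrow> bool" where
  "out_less G F A B \<longleftrightarrow> (\<exists>A' B' S e f w. A = S @ e # A' \<and> B = S @ f # B' \<and> e \<noteq> f \<and>
     tail G e = w \<and> tail G f = w \<and> (e, f) \<in> out_ord F w)"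

text \<open>\<open>cw_less G F v P Q\<close> is \<open>P <\<^sub>v Q\<close> in the clockwise sense; it includes that \<open>v\<close> is a common
  inner vertex.\<close>

definition cw_less ::
  "('v, 'e) pre_digraph \<Rightarrow> ('v, 'e) framing \<Rightarrow> 'v \<Rightarrow> 'e list \<Rightarrow> 'e list \<Rightarrow> bool" where
  "cw_less G F v P Q \<longleftrightarrow> v \<in> inner_verts G P \<inter> inner_verts G Q \<and>
     in_less G F (path_to G P v) (path_to G Q v) \<and>
     out_less G F (path_from G v Q) (path_from G v P)"

definition incoherent_at ::
  "('v, 'e) pre_digraph \<Rightarrow> ('v, 'e) framing \<Rightarrow> 'v \<Rightarrow> 'e list \<Rightarrow> 'e list \<Rightarrow> bool" where
  "incoherent_at G F v P Q \<longleftrightarrow> cw_less G F v P Q \<or> cw_less G F v Q P"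

definition coherent ::
  "('v, 'e) pre_digraph \<Rightarrow> ('v, 'e) framing \<Rightarrow> 'e list \<Rightarrow> 'e list \<Rightarrow> bool" where
  "coherent G F P Q \<longleftrightarrow> (\<forall>v \<in> inner_verts G P \<inter> inner_verts G Q. \<not> incoherent_at G F v P Q)"

definition clique ::
  "('v, 'e) pre_digraph \<Rightarrow> 'v \<Rightarrow> 'v \<Rightarrow> ('v, 'e) framing \<Rightarrow> 'e list set \<Rightarrow> bool" where
  "clique G s t F C \<longleftrightarrow> C \<subseteq> routes G s t \<and> (\<forall>P \<in> C. \<forall>Q \<in> C. coherent G F P Q)"

definition maximal_cliques ::
  "('v, 'e) pre_digraph \<Rightarrow> 'v \<Rightarrow> 'v \<Rightarrow> ('v, 'e) framing \<Rightarrow> 'e list set set" where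
  "maximal_cliques G s t F =
     {C. clique G s t F C \<and> (\<forall>D. clique G s t F D \<longrightarrow> C \<subseteq> D \<longrightarrow> D = C)}"

definition framing_step ::
  "('v, 'e) pre_digraph \<Rightarrow> 'v \<Rightarrow> 'v \<Rightarrow> ('v, 'e) framing \<Rightarrow> 'e list set \<Rightarrow> 'e list set \<Rightarrow> bool" where
  "framing_step G s t F C C' \<longleftrightarrow>
     C \<in> maximal_cliques G s t F \<and> C' \<in> maximal_cliques G s t F \<and>
     (\<exists>R R' u. R \<in> C \<and> C' = (C - {R}) \<union> {R'} \<and> cw_less G F u R R')"

definition framing_le ::
  "('v, 'e) pre_digraph \<Rightarrow> 'v \<Rightarrow> 'v \<Rightarrow> ('v, 'e) framing \<Rightarrow> 'e list set \<Rightarrow> 'e list set \<Rightarrow> bool" where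
  "framing_le G s t F C C' \<longleftrightarrow>
     C \<in> maximal_cliques G s t F \<and> C' \<in> maximal_cliques G s t F \<and>
     (framing_step G s t F)\<^sup>*\<^sup>* C C'"

definition cw_from ::
  "('v, 'e) pre_digraph \<Rightarrow> ('v, 'e) framing \<Rightarrow> 'e list set \<Rightarrow> 'e list set \<Rightarrow> bool" where
  "cw_from G F C C' \<longleftrightarrow>
     (\<forall>R \<in> C. \<forall>R' \<in> C'. \<forall>v \<in> inner_verts G R \<inter> inner_verts G R'.
        \<not> incoherent_at G F v R R' \<or> cw_less G F v R R')"

end

theory Submission
  imports Defs
begin

text \<open>Split the routes of a maximal clique \<open>C\<close> through a vertex \<open>u\<close> into pairs \<open>(Ru, uR)\<close>. Since
  no two routes cross at \<open>u\<close>, the pairs form a chain in the product order, and this chain is a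
  staircase: consecutive pairs share a coordinate, as otherwise a route could be added to \<open>C\<close>.
  Moreover \<open>C\<close> uses every arc. These two facts imply that being clockwise from is transitive on
  maximal cliques and holds along the steps of the framing poset.

  Conversely, let \<open>C\<close> be clockwise from \<open>C' \<noteq> C\<close>. Consecutive pairs \<open>(p, q')\<close>, \<open>(p, q)\<close>, \<open>(p', q)\<close>
  of a staircase of \<open>C\<close> form a corner, and replacing \<open>pq\<close> by \<open>p'q'\<close> yields a maximal clique one step
  above \<open>C\<close>. A crossing of some \<open>R \<in> C\<close> with some \<open>R' \<in> C'\<close> along a shortest possible common
  segment exhibits a corner for which the new clique is still clockwise from \<open>C'\<close>. Since the
  relation is a partial order on a finite set, iterating this leads from \<open>C\<close> to \<open>C'\<close>.\<close>

section \<open>Walks and the orders on them\<close>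

text \<open>The argument is carried out in an abstract locale that is closed under reversing all
  arcs, so that statements about leaving arcs can be derived from those about entering arcs. The
  obstacle is that a step up from \<open>C\<close> may overshoot \<open>C'\<close>. A route of
  \<open>C'\<close> that crosses the new route in the wrong sense is trapped between the walks of
  the corner. The shortest crossing is chosen because its own route in \<open>C'\<close> then has to
  cross every such trapped route, which is impossible inside a clique.\<close>

fun walk :: "'e set \<Rightarrow> ('e \<Rightarrow> 'v) \<Rightarrow> ('e \<Rightarrow> 'v) \<Rightarrow> 'v \<Rightarrow> 'e list \<Rightarrow> 'v \<Rightarrow> bool" where
  "walk E src dst u [] v \<longleftrightarrow> u = v"
| "walk E src dst u (e # p) v \<longleftrightarrow> e \<in> E \<and> src e = u \<and> walk E src dst (dst e) p v"

lemma walk_append: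
  "walk E src dst u (p @ q) v \<longleftrightarrow> (\<exists>w. walk E src dst u p w \<and> walk E src dst w q v)"
  by (induction p arbitrary: u) auto

lemma walk_rev: "walk E dst src v (rev p) u \<longleftrightarrow> walk E src dst u p v"
  by (induction p arbitrary: u) (auto simp: walk_append)

lemma walk_end_unique: "walk E src dst u p v \<Longrightarrow> walk E src dst u p w \<Longrightarrow> v = w"
  by (induction p arbitrary: u) auto

lemma walk_start_unique: "walk E src dst u p w \<Longrightarrow> walk E src dst v p w \<Longrightarrow> p \<noteq> [] \<Longrightarrow> u = v"
  by (cases p) auto

lemma walk_arcs: "walk E src dst u p v \<Longrightarrow> set p \<subseteq> E"
  by (induction p arbitrary: u) auto

text \<open>A list is incomparable to its proper prefixes, unlike in the usual lexicographic order:
  of two paths that never separate, neither is less.\<close>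

fun lex_less :: "('e \<Rightarrow> 'e \<Rightarrow> bool) \<Rightarrow> 'e list \<Rightarrow> 'e list \<Rightarrow> bool" where
  "lex_less r (e # A) (f # B) \<longleftrightarrow> r e f \<or> e = f \<and> lex_less r A B"
| "lex_less r _ _ \<longleftrightarrow> False"

lemma lex_less_Nil [simp]: "\<not> lex_less r [] B" "\<not> lex_less r A []"
  by (cases A; simp)+

lemma lex_less_trans:
  assumes "transp r"
  shows "lex_less r A B \<Longrightarrow> lex_less r B C \<Longrightarrow> lex_less r A C"
proof (induction A arbitrary: B C)
  case (Cons e A)
  then obtain f B' g C' where [simp]: "B = f # B'" "C = g # C'"
    by (cases B; cases C) auto
  show ?case using Cons.prems Cons.IH[of B' C'] transpD[OF assms, of e f g] by auto
qed simp

lemma lex_less_irrefl: "irreflp r \<Longrightarrow> \<not> lex_less r A A"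
  by (induction A) (auto dest: irreflpD)

lemma lex_less_append: "irreflp r \<Longrightarrow> lex_less r (S @ A) (S @ B) \<longleftrightarrow> lex_less r A B"
  by (induction S) (auto dest: irreflpD)

lemma lex_less_append_right: "lex_less r A B \<Longrightarrow> lex_less r (A @ A') (B @ B')"
  by (induction r A B rule: lex_less.induct) auto

lemma lex_less_iff:
  assumes "irreflp r"
  shows "lex_less r A B \<longleftrightarrow> (\<exists>S e f A' B'. A = S @ e # A' \<and> B = S @ f # B' \<and> r e f)"
proof
  show "lex_less r A B \<Longrightarrow> \<exists>S e f A' B'. A = S @ e # A' \<and> B = S @ f # B' \<and> r e f"
  proof (induction r A B rule: lex_less.induct)
    case (1 r e A f B)
    show ?case
    proof (cases "r e f")
      case True
      then show ?thesis by (intro exI[of _ "[]"]) auto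
    next
      case False
      with 1 obtain S e' f' A' B' where "e = f" "A = S @ e' # A'" "B = S @ f' # B'" "r e' f'"
        by auto
      then show ?thesis by (intro exI[of _ "e # S"]) auto
    qed
  qed auto
qed (auto simp: lex_less_append assms)

lemma lex_less_append_left_cases:
  "lex_less r X (U @ B) \<Longrightarrow> lex_less r X U \<or> (\<exists>X'. X = U @ X' \<and> lex_less r X' B)"
proof (induction U arbitrary: X)
  case (Cons u U)
  then show ?case by (cases X) auto
qed simp

lemma lex_less_append_right_cases:
  "lex_less r (U @ B) X \<Longrightarrow> lex_less r U X \<or> (\<exists>X'. X = U @ X' \<and> lex_less r B X')"
proof (induction U arbitrary: X)
  case (Cons u U)
  then show ?case by (cases X) auto
qed simp

lemma finite_chain_max:
  assumes "finite S" "S \<noteq> {}"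
    and total: "\<And>x y. x \<in> S \<Longrightarrow> y \<in> S \<Longrightarrow> le x y \<or> le y x"
    and trans: "\<And>x y z. le x y \<Longrightarrow> le y z \<Longrightarrow> le x z"
  shows "\<exists>m\<in>S. \<forall>x\<in>S. le x m"
  using assms(1,2) total
proof (induction S rule: finite_ne_induct)
  case (insert a S)
  then obtain m where m: "m \<in> S" "\<forall>x\<in>S. le x m" by blast
  have "le a a" using insert.prems[of a a] by simp
  moreover have "le a m \<or> le m a" using insert.prems[of a m] m(1) by simp
  ultimately show ?case using m trans by (metis insert_iff)
qed auto

text \<open>The arc orders at all vertices are merged into the strict relations \<open>ri\<close>
  and \<open>ro\<close>, which relate only arcs with a common head or tail. \<open>rank\<close>
  expresses acyclicity and takes values in \<open>int\<close> so that it can be negated in the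
  reversed graph. \<open>route_through\<close> and \<open>route_ex\<close> are what is kept of the
  unique source and sink.\<close>

locale framed_dag =
  fixes E :: "'e set" and src dst :: "'e \<Rightarrow> 'v" and s t :: 'v
    and rank :: "'v \<Rightarrow> int" and ri ro :: "'e \<Rightarrow> 'e \<Rightarrow> bool"
  assumes finite_E: "finite E"
    and rank_less: "e \<in> E \<Longrightarrow> rank (src e) < rank (dst e)"
    and route_through: "e \<in> E \<Longrightarrow> \<exists>A B. walk E src dst s (A @ e # B) t"
    and route_ex: "\<exists>R. walk E src dst s R t"
    and ri_dst: "ri e f \<Longrightarrow> dst e = dst f"
    and ro_src: "ro e f \<Longrightarrow> src e = src f"
    and ri_irrefl: "irreflp ri" and ro_irrefl: "irreflp ro"
    and ri_trans: "transp ri" and ro_trans: "transp ro"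
    and ri_total: "e \<in> E \<Longrightarrow> f \<in> E \<Longrightarrow> dst e = dst f \<Longrightarrow> e \<noteq> f \<Longrightarrow> ri e f \<or> ri f e"
    and ro_total: "e \<in> E \<Longrightarrow> f \<in> E \<Longrightarrow> src e = src f \<Longrightarrow> e \<noteq> f \<Longrightarrow> ro e f \<or> ro f e"
begin

abbreviation wlk :: "'v \<Rightarrow> 'e list \<Rightarrow> 'v \<Rightarrow> bool" where
  "wlk \<equiv> walk E src dst"

definition il :: "'e list \<Rightarrow> 'e list \<Rightarrow> bool" where
  "il A B \<longleftrightarrow> lex_less ri (rev A) (rev B)"

definition ol :: "'e list \<Rightarrow> 'e list \<Rightarrow> bool" where
  "ol A B \<longleftrightarrow> lex_less ro A B"

text \<open>\<open>il\<close> and \<open>ol\<close> are the orders on the paths \<open>Pv\<close> and \<open>vP\<close>, and \<open>cross P Q\<close> means that \<open>P\<close> is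
  clockwise below \<open>Q\<close> at some vertex. The splitting vertex need not be mentioned, because paths
  comparable under \<open>il\<close> end in the same vertex.\<close>

definition cross :: "'e list \<Rightarrow> 'e list \<Rightarrow> bool" where
  "cross P Q \<longleftrightarrow> (\<exists>A B A' B'. P = A @ B \<and> Q = A' @ B' \<and> il A A' \<and> ol B' B)"

text \<open>The reversal of the arc orders is what makes this duality preserve \<open>cross\<close>: it exchanges
  \<open>il\<close> and \<open>ol\<close> up to converse.\<close>

lemma reversal: "framed_dag E dst src t s (\<lambda>v. - rank v) (\<lambda>e f. ro f e) (\<lambda>e f. ri f e)"
proof
  show "irreflp (\<lambda>e f. ro f e)" "irreflp (\<lambda>e f. ri f e)"
    using ri_irrefl ro_irrefl by (auto simp: irreflp_def)
  show "transp (\<lambda>e f. ro f e)" "transp (\<lambda>e f. ri f e)"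
    by (rule transpI, metis ri_trans ro_trans transpD)+
  show "\<exists>R. walk E dst src t R s"
    using route_ex walk_rev[of E dst src] by blast
  fix e assume "e \<in> E"
  then obtain A B where "wlk s (A @ e # B) t" using route_through by blast
  then have "walk E dst src t (rev (A @ e # B)) s" by (simp only: walk_rev)
  then show "\<exists>A B. walk E dst src t (A @ e # B) s" by auto
qed (use finite_E rank_less ri_dst ro_src ri_total ro_total in auto)

lemma il_trans: "il A B \<Longrightarrow> il B C \<Longrightarrow> il A C"
  unfolding il_def using lex_less_trans ri_trans by blast

lemma ol_trans: "ol A B \<Longrightarrow> ol B C \<Longrightarrow> ol A C"
  unfolding ol_def using lex_less_trans ro_trans by blast

lemma il_irrefl [simp]: "\<not> il A A"
  unfolding il_def using lex_less_irrefl ri_irrefl by blast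

lemma ol_irrefl [simp]: "\<not> ol A A"
  unfolding ol_def using lex_less_irrefl ro_irrefl by blast

lemma ri_irrefl' [simp]: "\<not> ri e e"
  using ri_irrefl by (auto dest: irreflpD)

lemma ro_irrefl' [simp]: "\<not> ro e e"
  using ro_irrefl by (auto dest: irreflpD)

lemma ri_asym: "ri e f \<Longrightarrow> \<not> ri f e"
  using ri_trans ri_irrefl' by (metis transpD)

lemma il_asym: "il A B \<Longrightarrow> \<not> il B A"
  using il_trans il_irrefl by blast

lemma ol_asym: "ol A B \<Longrightarrow> \<not> ol B A"
  using ol_trans ol_irrefl by blast

lemma il_append [simp]: "il (A @ S) (B @ S) \<longleftrightarrow> il A B"
  by (simp add: il_def lex_less_append ri_irrefl)

lemma ol_append [simp]: "ol (S @ A) (S @ B) \<longleftrightarrow> ol A B"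
  by (simp add: ol_def lex_less_append ro_irrefl)

lemma il_Cons_append [simp]: "il (A @ e # S) (B @ f # S) \<longleftrightarrow> ri e f \<or> e = f \<and> il A B"
  by (simp add: il_def lex_less_append ri_irrefl)

lemma il_Cons_append' [simp]:
  "il (e # S) (f # S) \<longleftrightarrow> ri e f"
  "il (A @ e # S) (f # S) \<longleftrightarrow> ri e f"
  "il (e # S) (B @ f # S) \<longleftrightarrow> ri e f"
  by (simp_all add: il_def lex_less_append ri_irrefl)

lemma ol_Cons [simp]: "ol (e # A) (f # B) \<longleftrightarrow> ro e f \<or> e = f \<and> ol A B"
  by (simp add: ol_def)

lemma il_Nil [simp]: "\<not> il [] B" "\<not> il A []"
  by (simp_all add: il_def)

lemma ol_Nil [simp]: "\<not> ol [] B" "\<not> ol A []"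
  by (simp_all add: ol_def)

lemma il_iff: "il A B \<longleftrightarrow> (\<exists>A' B' e f S. A = A' @ e # S \<and> B = B' @ f # S \<and> ri e f)"
proof
  assume "il A B"
  then obtain S e f A' B' where "rev A = S @ e # A'" "rev B = S @ f # B'" "ri e f"
    unfolding il_def lex_less_iff[OF ri_irrefl] by blast
  then show "\<exists>A' B' e f S. A = A' @ e # S \<and> B = B' @ f # S \<and> ri e f"
    by (intro exI[of _ "rev A'"] exI[of _ "rev B'"] exI[of _ e] exI[of _ f] exI[of _ "rev S"])
      (simp add: rev_eq_append_conv)
qed auto

lemma ol_iff: "ol A B \<longleftrightarrow> (\<exists>A' B' e f S. A = S @ e # A' \<and> B = S @ f # B' \<and> ro e f)"
  unfolding ol_def lex_less_iff[OF ro_irrefl] by blast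

lemma il_extend: "il A B \<Longrightarrow> il (A' @ A) (B' @ B)"
  by (simp add: il_def lex_less_append_right)

lemma ol_extend: "ol A B \<Longrightarrow> ol (A @ A') (B @ B')"
  by (simp add: ol_def lex_less_append_right)

lemma il_append_left_cases: "il X (A @ U) \<Longrightarrow> il X U \<or> (\<exists>X'. X = X' @ U \<and> il X' A)"
  unfolding il_def using lex_less_append_left_cases[of ri "rev X" "rev U" "rev A"]
  by (auto simp: rev_eq_append_conv intro: exI[of _ "rev _"])

lemma il_append_right_cases: "il (A @ U) X \<Longrightarrow> il U X \<or> (\<exists>X'. X = X' @ U \<and> il A X')"
  unfolding il_def using lex_less_append_right_cases[of ri "rev U" "rev A" "rev X"]
  by (auto simp: rev_eq_append_conv intro: exI[of _ "rev _"])

lemma ol_append_left_cases: "ol X (U @ B) \<Longrightarrow> ol X U \<or> (\<exists>X'. X = U @ X' \<and> ol X' B)"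
  unfolding ol_def by (rule lex_less_append_left_cases)

lemma ol_append_right_cases: "ol (U @ B) X \<Longrightarrow> ol U X \<or> (\<exists>X'. X = U @ X' \<and> ol B X')"
  unfolding ol_def by (rule lex_less_append_right_cases)

section \<open>Crossings of concatenated paths\<close>

lemma crossI: "il A A' \<Longrightarrow> ol B' B \<Longrightarrow> cross (A @ B) (A' @ B')"
  unfolding cross_def by blast

lemma cross_extend: "cross P Q \<Longrightarrow> cross (X @ P @ Y) (X' @ Q @ Y')"
proof -
  assume "cross P Q"
  then obtain A B A' B' where "P = A @ B" "Q = A' @ B'" "il A A'" "ol B' B"
    unfolding cross_def by blast
  then show ?thesis
    using crossI[of "X @ A" "X' @ A'" "B' @ Y'" "B @ Y"] by (simp add: il_extend ol_extend)
qed

lemma cross_extends: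
  "cross P Q \<Longrightarrow> cross (X @ P) Q" "cross P Q \<Longrightarrow> cross (P @ Y) Q"
  "cross P Q \<Longrightarrow> cross P (X @ Q)" "cross P Q \<Longrightarrow> cross P (Q @ Y)"
  using cross_extend[of P Q X "[]" "[]" "[]"] cross_extend[of P Q "[]" Y "[]" "[]"]
    cross_extend[of P Q "[]" "[]" X "[]"] cross_extend[of P Q "[]" "[]" "[]" Y] by auto

text \<open>The splitting vertex may be moved along the common segment. Either both comparisons are
  decided within one of the two parts, or the common segment contains the junction and the split can
  be made there.\<close>

lemma cross_append_right:
  assumes "cross Z (A @ B)"
  obtains "cross Z A" | "cross Z B" | X Y where "Z = X @ Y" "il X A" "ol B Y"
proof -
  obtain X Y X' Y' where Z: "Z = X @ Y" "A @ B = X' @ Y'" and less: "il X X'" "ol Y' Y"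
    using assms unfolding cross_def by blast
  from Z(2) consider U where "X' = A @ U" "B = U @ Y'" | U where "A = X' @ U" "Y' = U @ B"
    by (auto simp: append_eq_append_conv2)
  then show thesis
  proof cases
    case 1
    then consider "il X U" | X'' where "X = X'' @ U" "il X'' A"
      using less il_append_left_cases by blast
    then show thesis
    proof cases
      assume "il X U"
      then have "cross Z B" using crossI[of X U Y' Y] less Z 1 by simp
      then show thesis by (rule that)
    next
      fix X'' assume "X = X'' @ U" "il X'' A"
      then show thesis using that(3)[of X'' "U @ Y"] less Z 1 by simp
    qed
  next
    case 2
    then consider "ol U Y" | Y'' where "Y = U @ Y''" "ol B Y''"
      using less ol_append_right_cases by blast
    then show thesis
    proof cases
      assume "ol U Y"
      then have "cross Z A" using crossI[of X X' U Y] less Z 2 by simp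
      then show thesis by (rule that)
    next
      fix Y'' assume "Y = U @ Y''" "ol B Y''"
      then show thesis using that(3)[of "X @ U" Y''] less Z 2 by simp
    qed
  qed
qed

lemma cross_append_left:
  assumes "cross (A @ B) Z"
  obtains "cross A Z" | "cross B Z" | X Y where "Z = X @ Y" "il A X" "ol Y B"
proof -
  obtain X Y X' Y' where Z: "Z = X @ Y" "A @ B = X' @ Y'" and less: "il X' X" "ol Y Y'"
    using assms unfolding cross_def by blast
  from Z(2) consider U where "X' = A @ U" "B = U @ Y'" | U where "A = X' @ U" "Y' = U @ B"
    by (auto simp: append_eq_append_conv2)
  then show thesis
  proof cases
    case 1
    then consider "il U X" | X'' where "X = X'' @ U" "il A X''"
      using less il_append_right_cases by blast
    then show thesis
    proof cases
      assume "il U X"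
      then have "cross B Z" using crossI[of U X Y Y'] less Z 1 by simp
      then show thesis by (rule that)
    next
      fix X'' assume "X = X'' @ U" "il A X''"
      then show thesis using that(3)[of X'' "U @ Y"] less Z 1 by simp
    qed
  next
    case 2
    then consider "ol Y U" | Y'' where "Y = U @ Y''" "ol Y'' B"
      using less ol_append_left_cases by blast
    then show thesis
    proof cases
      assume "ol Y U"
      then have "cross A Z" using crossI[of X' X Y U] less Z 2 by simp
      then show thesis by (rule that)
    next
      fix Y'' assume "Y = U @ Y''" "ol Y'' B"
      then show thesis using that(3)[of "X @ U" Y''] less Z 2 by simp
    qed
  qed
qed

lemma not_cross_append:
  "\<not> cross Z (A @ B) \<Longrightarrow> \<not> cross Z A \<and> \<not> cross Z B"
  "\<not> cross (A @ B) Z \<Longrightarrow> \<not> cross A Z \<and> \<not> cross B Z"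
  using cross_extends by blast+

section \<open>Consequences of acyclicity\<close>

lemma walk_rank: "wlk u p v \<Longrightarrow> rank u \<le> rank v \<and> (p \<noteq> [] \<longrightarrow> rank u < rank v)"
proof (induction p arbitrary: u)
  case (Cons e p)
  then show ?case using rank_less[of e] by fastforce
qed simp

lemma closed_walk_Nil: "wlk u p u \<Longrightarrow> p = []"
  using walk_rank by blast

lemma split_unique:
  assumes "A @ B = A' @ B'" "wlk u A v" "wlk u A' v"
  shows "A = A' \<and> B = B'"
proof -
  consider U where "A' = A @ U" | U where "A = A' @ U"
    using assms(1) by (auto simp: append_eq_append_conv2)
  then show ?thesis
  proof cases
    case 1
    then have "wlk v U v" using assms by (metis walk_append walk_end_unique)
    then show ?thesis using 1 closed_walk_Nil assms(1) by auto
  next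
    case 2
    then have "wlk v U v" using assms by (metis walk_append walk_end_unique)
    then show ?thesis using 2 closed_walk_Nil assms(1) by auto
  qed
qed

lemma il_walk:
  assumes "il A A' \<or> il A' A" "wlk a (A @ B) b" "wlk c A' v"
  shows "wlk a A v \<and> wlk v B b"
proof -
  obtain A1 A1' e f S where *: "A = A1 @ e # S" "A' = A1' @ f # S" "dst e = dst f"
    using assms(1) il_iff ri_dst by metis
  then show ?thesis using assms(2,3)
    by (auto simp: walk_append) (metis walk_end_unique)+
qed

lemma ol_total: "wlk u A t \<Longrightarrow> wlk u B t \<Longrightarrow> A = B \<or> ol A B \<or> ol B A"
proof (induction A arbitrary: u B)
  case Nil
  then show ?case using closed_walk_Nil by auto
next
  case (Cons e A)
  show ?case
  proof (cases B)
    case Nil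
    then show ?thesis using Cons.prems closed_walk_Nil[of u "e # A"] by auto
  next
    case (Cons f B')
    then show ?thesis using Cons.prems Cons.IH[of "dst e" B'] ro_total[of e f] by auto
  qed
qed

lemma lex_less_flip: "lex_less (\<lambda>e f. r f e) X Y \<longleftrightarrow> lex_less r Y X"
  by (induction r X Y rule: lex_less.induct) auto

lemma reversal_il: "framed_dag.il (\<lambda>e f. ro f e) A B \<longleftrightarrow> ol (rev B) (rev A)"
  by (simp add: framed_dag.il_def[OF reversal] ol_def lex_less_flip[of ro])

lemma reversal_ol: "framed_dag.ol (\<lambda>e f. ri f e) A B \<longleftrightarrow> il (rev B) (rev A)"
  by (simp add: framed_dag.ol_def[OF reversal] il_def lex_less_flip[of ri])

lemma reversal_cross:
  "framed_dag.cross (\<lambda>e f. ro f e) (\<lambda>e f. ri f e) P Q \<longleftrightarrow> cross (rev P) (rev Q)"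
proof -
  have split: "R = A @ B \<longleftrightarrow> rev R = rev B @ rev A" for R A B :: "'e list"
    by (metis rev_append rev_rev_ident)
  have "(\<exists>A B A' B'. P = A @ B \<and> Q = A' @ B' \<and> ol (rev A') (rev A) \<and> il (rev B) (rev B')) \<longleftrightarrow>
    (\<exists>A B A' B'. rev P = B @ A \<and> rev Q = B' @ A' \<and> ol A' A \<and> il B B')"
    unfolding split[of P] split[of Q] by (metis rev_rev_ident)
  then show ?thesis
    unfolding framed_dag.cross_def[OF reversal] reversal_il reversal_ol cross_def by blast
qed

lemma il_total:
  assumes "wlk s A u" "wlk s B u"
  shows "A = B \<or> il A B \<or> il B A"
proof -
  interpret rd: framed_dag E dst src t s "\<lambda>v. - rank v" "\<lambda>e f. ro f e" "\<lambda>e f. ri f e"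
    by (rule reversal)
  show ?thesis
    using rd.ol_total[of u "rev A" "rev B"] assms walk_rev[of E dst src]
    by (auto simp: reversal_ol)
qed

section \<open>Maximal cliques\<close>

definition clq :: "'e list set \<Rightarrow> bool" where
  "clq C \<longleftrightarrow> (\<forall>R\<in>C. wlk s R t) \<and> (\<forall>P\<in>C. \<forall>Q\<in>C. \<not> cross P Q)"

text \<open>Maximality is tested on single routes, which is enough because a route never crosses
  itself, see \<open>no_self_cross\<close>.\<close>

definition mclq :: "'e list set \<Rightarrow> bool" where
  "mclq C \<longleftrightarrow> clq C \<and>
     (\<forall>R. wlk s R t \<and> (\<forall>Z\<in>C. \<not> cross R Z \<and> \<not> cross Z R) \<longrightarrow> R \<in> C)"

definition pairs :: "'e list set \<Rightarrow> 'v \<Rightarrow> ('e list \<times> 'e list) set" where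
  "pairs C u = {(A, B). wlk s A u \<and> wlk u B t \<and> A @ B \<in> C}"

text \<open>Incoherence at a vertex means strict inequalities in opposite directions in the two
  coordinates, so routes through that vertex do not cross there exactly when their pairs are
  comparable.\<close>

definition ple :: "'e list \<times> 'e list \<Rightarrow> 'e list \<times> 'e list \<Rightarrow> bool" where
  "ple x y \<longleftrightarrow> (fst x = fst y \<or> il (fst x) (fst y)) \<and> (snd x = snd y \<or> ol (snd x) (snd y))"

lemma ple_simp [simp]: "ple (A, B) (A', B') \<longleftrightarrow> (A = A' \<or> il A A') \<and> (B = B' \<or> ol B B')"
  by (simp add: ple_def)

lemma ple_trans: "ple x y \<Longrightarrow> ple y z \<Longrightarrow> ple x z"
  unfolding ple_def
  using il_trans[of "fst x" "fst y" "fst z"] ol_trans[of "snd x" "snd y" "snd z"] by auto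

lemma mclq_clq: "mclq C \<Longrightarrow> clq C"
  by (simp add: mclq_def)

lemma clqD: "clq C \<Longrightarrow> P \<in> C \<Longrightarrow> Q \<in> C \<Longrightarrow> \<not> cross P Q"
  by (simp add: clq_def)

lemma mclqI_mem:
  "mclq C \<Longrightarrow> wlk s R t \<Longrightarrow> (\<And>Z. Z \<in> C \<Longrightarrow> \<not> cross R Z) \<Longrightarrow> (\<And>Z. Z \<in> C \<Longrightarrow> \<not> cross Z R) \<Longrightarrow> R \<in> C"
  by (simp add: mclq_def)

lemma clq_walk: "clq C \<Longrightarrow> R \<in> C \<Longrightarrow> wlk s R t"
  by (simp add: clq_def)

lemma pairsD: "(A, B) \<in> pairs C u \<Longrightarrow> wlk s A u \<and> wlk u B t \<and> A @ B \<in> C"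
  by (simp add: pairs_def)

lemma pairsI: "clq C \<Longrightarrow> A @ B \<in> C \<Longrightarrow> wlk s A u \<Longrightarrow> (A, B) \<in> pairs C u"
  using clq_walk[of C "A @ B"] by (auto simp: pairs_def walk_append) (metis walk_end_unique)

lemma pairsI_il:
  "clq C \<Longrightarrow> A @ B \<in> C \<Longrightarrow> il A A' \<or> il A' A \<Longrightarrow> wlk c A' u \<Longrightarrow> (A, B) \<in> pairs C u"
  using il_walk[of A A' s B t c u] clq_walk[of C "A @ B"] by (simp add: pairs_def)

lemma pairs_il_imp_ple:
  assumes "clq C" "(A, B) \<in> pairs C u" "(A', B') \<in> pairs C u" "il A A'"
  shows "ple (A, B) (A', B')"
  using assms clqD[OF assms(1), of "A @ B" "A' @ B'"] crossI[of A A' B' B] ol_total[of u B B']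
  by (auto dest!: pairsD)

lemma pairs_ol_imp_ple:
  assumes "clq C" "(A, B) \<in> pairs C u" "(A', B') \<in> pairs C u" "ol B B'"
  shows "ple (A, B) (A', B')"
  using assms clqD[OF assms(1), of "A' @ B'" "A @ B"] crossI[of A' A B B'] il_total[of A u A']
  by (auto dest!: pairsD)

lemma pairs_total:
  assumes "clq C" "x \<in> pairs C u" "y \<in> pairs C u"
  shows "ple x y \<or> ple y x"
proof -
  obtain A B A' B' where [simp]: "x = (A, B)" "y = (A', B')" by force
  consider "A = A'" | "il A A'" | "il A' A"
    using il_total[of A u A'] assms(2,3) by (auto dest!: pairsD)
  then show ?thesis
    using pairs_il_imp_ple[OF assms(1), of A B u A' B'] pairs_il_imp_ple[OF assms(1), of A' B' u A B]
      ol_total[of u B B'] assms(2,3)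
    by cases (auto dest!: pairsD)
qed

lemma walk_distinct: "wlk u p v \<Longrightarrow> distinct p"
proof (induction p arbitrary: u)
  case (Cons e p)
  have False if e: "e \<in> set p"
  proof -
    obtain X Y where "p = X @ e # Y" using split_list[OF e] by blast
    then have "wlk (dst e) X (src e)" "e \<in> E" using Cons.prems by (auto simp: walk_append)
    then show False using walk_rank rank_less by fastforce
  qed
  then show ?case using Cons by auto
qed simp

lemma finite_walks: "finite {p. wlk u p v}"
  using finite_subset_distinct[OF finite_E] walk_distinct walk_arcs
  by (metis (no_types, lifting) finite_subset mem_Collect_eq subsetI)

lemma finite_pairs: "finite (pairs C u)"
  by (rule finite_subset[OF _ finite_cartesian_product[OF finite_walks[of s u] finite_walks[of u t]]])
    (auto simp: pairs_def)

lemma pairs_max: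
  assumes "clq C" "S \<subseteq> pairs C u" "S \<noteq> {}"
  obtains A B where "(A, B) \<in> S" "\<And>x. x \<in> S \<Longrightarrow> ple x (A, B)"
proof -
  have "\<exists>m\<in>S. \<forall>x\<in>S. ple x m"
    using finite_subset[OF assms(2) finite_pairs] assms(3)
  proof (rule finite_chain_max)
    show "ple x y \<or> ple y x" if "x \<in> S" "y \<in> S" for x y
      using pairs_total[OF assms(1)] assms(2) that by blast
  qed (rule ple_trans)
  then show thesis using that by fastforce
qed

lemma pairs_min:
  assumes "clq C" "S \<subseteq> pairs C u" "S \<noteq> {}"
  obtains A B where "(A, B) \<in> S" "\<And>x. x \<in> S \<Longrightarrow> ple (A, B) x"
proof -
  have "\<exists>m\<in>S. \<forall>x\<in>S. ple m x"
    using finite_subset[OF assms(2) finite_pairs] assms(3)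
  proof (rule finite_chain_max)
    show "ple y x \<or> ple x y" if "x \<in> S" "y \<in> S" for x y
      using pairs_total[OF assms(1)] assms(2) that by blast
    show "ple z x" if "ple y x" "ple z y" for x y z using ple_trans that by blast
  qed
  then show thesis using that by fastforce
qed

lemma coherent_mem:
  assumes C: "mclq C" and w: "wlk s (A @ B) t" "wlk s A u" and V: "\<And>V. V \<in> C \<Longrightarrow>
      \<not> cross V A \<and> \<not> cross A V \<and> \<not> cross V B \<and> \<not> cross B V"
    and P: "\<And>X Y. (X, Y) \<in> pairs C u \<Longrightarrow> \<not> (il X A \<and> ol B Y) \<and> \<not> (il A X \<and> ol Y B)"
  shows "(A, B) \<in> pairs C u"
proof -
  note clq = mclq_clq[OF C]
  have "A @ B \<in> C"
  proof (rule mclqI_mem[OF C w(1)])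
    show "\<not> cross (A @ B) Z" if "Z \<in> C" for Z
    proof
      assume "cross (A @ B) Z"
      then show False
        by (rule cross_append_left) (use V[OF that] P pairsI_il[OF clq _ _ w(2)] that in blast)+
    qed
    show "\<not> cross Z (A @ B)" if "Z \<in> C" for Z
    proof
      assume "cross Z (A @ B)"
      then show False
        by (rule cross_append_right) (use V[OF that] P pairsI_il[OF clq _ _ w(2)] that in blast)+
    qed
  qed
  then show ?thesis using pairsI[OF clq _ w(2)] by blast
qed

text \<open>A route crossing \<open>A @ B\<close> away from \<open>u\<close> also crosses \<open>A @ B1\<close> or \<open>A1 @ B\<close>, so only
  crossings at \<open>u\<close> can prevent \<open>A @ B\<close> from belonging to \<open>C\<close>.\<close>

lemma splice_mem:
  assumes C: "mclq C" and 1: "(A, B1) \<in> pairs C u" and 2: "(A1, B) \<in> pairs C u"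
    and less: "\<And>X Y. (X, Y) \<in> pairs C u \<Longrightarrow> \<not> (il X A \<and> ol B Y)"
      "\<And>X Y. (X, Y) \<in> pairs C u \<Longrightarrow> \<not> (il A X \<and> ol Y B)"
  shows "(A, B) \<in> pairs C u"
proof (rule coherent_mem[OF C])
  note clq = mclq_clq[OF C]
  show "wlk s (A @ B) t" "wlk s A u" using 1 2 by (auto simp: walk_append dest!: pairsD)
  have mem: "A @ B1 \<in> C" "A1 @ B \<in> C" using 1 2 by (auto dest!: pairsD)
  show "\<not> cross V A \<and> \<not> cross A V \<and> \<not> cross V B \<and> \<not> cross B V" if "V \<in> C" for V
    using clqD[OF clq that mem(1)] clqD[OF clq mem(1) that] clqD[OF clq that mem(2)]
      clqD[OF clq mem(2) that] not_cross_append by blast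
qed (use less in blast)

text \<open>If both coordinates grew strictly from the largest pair of \<open>Lo\<close> to the
  smallest pair of \<open>Hi\<close>, then \<open>(A, B')\<close> would be comparable to all pairs
  and hence belong to the chain, although it fits into neither \<open>Lo\<close> nor
  \<open>Hi\<close>. The cut is arbitrary so that each application can choose the place of the
  step.\<close>

lemma staircase:
  assumes C: "mclq C" and un: "Lo \<union> Hi = pairs C u" and ne: "Lo \<noteq> {}" "Hi \<noteq> {}"
    and le: "\<And>x y. x \<in> Lo \<Longrightarrow> y \<in> Hi \<Longrightarrow> ple x y"
  obtains A B A' B' where "(A, B) \<in> Lo" "(A', B') \<in> Hi" "\<And>x. x \<in> Lo \<Longrightarrow> ple x (A, B)"
    "\<And>y. y \<in> Hi \<Longrightarrow> ple (A', B') y" "A = A' \<or> B = B'"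
proof -
  note clq = mclq_clq[OF C]
  obtain A B where 1: "(A, B) \<in> Lo" "\<And>x. x \<in> Lo \<Longrightarrow> ple x (A, B)"
    using pairs_max[OF clq, of Lo u] un ne by auto
  obtain A' B' where 2: "(A', B') \<in> Hi" "\<And>x. x \<in> Hi \<Longrightarrow> ple (A', B') x"
    using pairs_min[OF clq, of Hi u] un ne by auto
  have "A = A' \<or> B = B'"
  proof (rule ccontr)
    assume ne: "\<not> ?thesis"
    then have lt: "il A A'" "ol B B'" using le[OF 1(1) 2(1)] by auto
    have "(A, B') \<in> pairs C u"
    proof (rule splice_mem[OF C])
      fix X Y assume "(X, Y) \<in> pairs C u"
      then have "(X, Y) \<in> Lo \<or> (X, Y) \<in> Hi" using un by auto
      then have "ple (X, Y) (A, B) \<or> ple (A', B') (X, Y)" using 1 2 by blast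
      then show "\<not> (il X A \<and> ol B' Y)" "\<not> (il A X \<and> ol Y B')"
        using lt il_asym ol_asym il_trans ol_trans by (metis ple_simp)+
    qed (use 1 2 un in auto)
    then have "(A, B') \<in> Lo \<or> (A, B') \<in> Hi" using un by auto
    then show False
      using 1(2)[of "(A, B')"] 2(2)[of "(A, B')"] lt ne il_asym ol_asym by auto
  qed
  then show thesis using that 1 2 by blast
qed

section \<open>Every arc is used by every maximal clique\<close>

lemma no_self_cross: "wlk s R t \<Longrightarrow> \<not> cross R R"
proof
  assume R: "wlk s R t" "cross R R"
  then obtain A B A' B' where *: "R = A @ B" "R = A' @ B'" "il A A'" "ol B' B"
    unfolding cross_def by blast
  then have "wlk s (A' @ B') t" using R by simp
  then obtain v where "wlk s A' v" unfolding walk_append by blast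
  then have "wlk s A v" using il_walk[of A A' s B t s v] * R by auto
  then have "A = A'" using split_unique * \<open>wlk s A' v\<close> by metis
  then show False using * by simp
qed

lemma mclq_nonempty: "mclq C \<Longrightarrow> C \<noteq> {}"
  using route_ex no_self_cross unfolding mclq_def by blast

text \<open>This finds an initial part to which a walk \<open>L\<close> leaving \<open>u\<close> can
  be attached without a crossing decided within \<open>L\<close>: \<open>A\<close> belongs to the
  largest pair whose second coordinate is below \<open>L\<close>, or to the smallest pair if there
  is none.\<close>

lemma exists_in_walk:
  assumes clq: "clq C" and ne: "pairs C u \<noteq> {}"
  obtains A B where "(A, B) \<in> pairs C u"
    "\<And>X Y. (X, Y) \<in> pairs C u \<Longrightarrow> ol Y L \<Longrightarrow> \<not> il A X"
    "\<And>X Y. (X, Y) \<in> pairs C u \<Longrightarrow> ol L Y \<Longrightarrow> \<not> il X A"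
proof (cases "{(X, Y) \<in> pairs C u. ol Y L} = {}")
  case True
  obtain A B where "(A, B) \<in> pairs C u" "\<And>x. x \<in> pairs C u \<Longrightarrow> ple (A, B) x"
    using pairs_min[OF clq order_refl ne] by blast
  moreover have "\<not> il X A" if "ple (A, B) (X, Y)" for X Y using that il_asym by auto
  ultimately show thesis using that[of A B] True by blast
next
  case False
  obtain A B where 1: "(A, B) \<in> {(X, Y) \<in> pairs C u. ol Y L}"
    "\<And>x. x \<in> {(X, Y) \<in> pairs C u. ol Y L} \<Longrightarrow> ple x (A, B)"
    using pairs_max[OF clq _ False] by blast
  show thesis
  proof (rule that)
    show "(A, B) \<in> pairs C u" using 1 by simp
    show "\<not> il A X" if "(X, Y) \<in> pairs C u" "ol Y L" for X Y
      using 1(2)[of "(X, Y)"] that il_asym by auto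
    show "\<not> il X A" if "(X, Y) \<in> pairs C u" "ol L Y" for X Y
      using pairs_ol_imp_ple[OF clq, of A B u X Y] 1(1) that ol_trans[of B L Y] il_asym[of X A] by auto
  qed
qed

lemma exists_out_walk:
  assumes clq: "clq C" and ne: "pairs C u \<noteq> {}"
  obtains A B where "(A, B) \<in> pairs C u"
    "\<And>X Y. (X, Y) \<in> pairs C u \<Longrightarrow> il X L \<Longrightarrow> \<not> ol B Y"
    "\<And>X Y. (X, Y) \<in> pairs C u \<Longrightarrow> il L X \<Longrightarrow> \<not> ol Y B"
proof (cases "{(X, Y) \<in> pairs C u. il X L} = {}")
  case True
  obtain A B where "(A, B) \<in> pairs C u" "\<And>x. x \<in> pairs C u \<Longrightarrow> ple (A, B) x"
    using pairs_min[OF clq order_refl ne] by blast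
  moreover have "\<not> ol Y B" if "ple (A, B) (X, Y)" for X Y using that ol_asym by auto
  ultimately show thesis using that[of A B] True by blast
next
  case False
  obtain A B where 1: "(A, B) \<in> {(X, Y) \<in> pairs C u. il X L}"
    "\<And>x. x \<in> {(X, Y) \<in> pairs C u. il X L} \<Longrightarrow> ple x (A, B)"
    using pairs_max[OF clq _ False] by blast
  show thesis
  proof (rule that)
    show "(A, B) \<in> pairs C u" using 1 by simp
    show "\<not> ol B Y" if "(X, Y) \<in> pairs C u" "il X L" for X Y
      using 1(2)[of "(X, Y)"] that ol_asym by auto
    show "\<not> ol Y B" if "(X, Y) \<in> pairs C u" "il L X" for X Y
      using pairs_il_imp_ple[OF clq, of A B u X Y] 1(1) that il_trans[of A L X] ol_asym[of Y B] by auto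
  qed
qed

text \<open>If some arc is unused, there is a shortest walk \<open>L\<close> that connects two vertices visited by \<open>C\<close> and
  contains an unused arc. It meets \<open>C\<close> only in its end points, and can be continued in both
  directions along \<open>C\<close> to a route which is coherent with \<open>C\<close>.\<close>

lemma arc_used:
  assumes C: "mclq C" and e: "e \<in> E"
  shows "\<exists>R\<in>C. e \<in> set R"
proof (rule ccontr)
  assume unused: "\<not> ?thesis"
  note clq = mclq_clq[OF C]
  define conn where "conn L \<longleftrightarrow> (\<exists>u w a. pairs C u \<noteq> {} \<and> pairs C w \<noteq> {} \<and> wlk u L w \<and>
    a \<in> set L \<and> (\<forall>R\<in>C. a \<notin> set R))" for L
  obtain R where R: "R \<in> C" using mclq_nonempty[OF C] by blast
  then have st: "([], R) \<in> pairs C s" "(R, []) \<in> pairs C t" using clq_walk[OF clq] by (auto simp: pairs_def)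
  obtain A0 B0 where "wlk s (A0 @ e # B0) t" using route_through[OF e] by blast
  then have "conn (A0 @ e # B0)"
    unfolding conn_def using st unused by (intro exI[of _ s] exI[of _ t] exI[of _ e]) auto
  then obtain L where L: "conn L" and min: "\<And>M. conn M \<Longrightarrow> length L \<le> length M"
    using ex_has_least_nat[of conn _ length] by blast
  then obtain u w a where u: "pairs C u \<noteq> {}" and w: "pairs C w \<noteq> {}" and walk: "wlk u L w"
    and a: "a \<in> set L" "\<forall>R\<in>C. a \<notin> set R"
    unfolding conn_def by blast
  have interior: "pairs C v = {}" if "L = X @ Y" "X \<noteq> []" "Y \<noteq> []" "wlk u X v" for X Y v
  proof (rule ccontr)
    assume v: "pairs C v \<noteq> {}"
    have "wlk v Y w" using walk that by (metis walk_append walk_end_unique)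
    moreover have "a \<in> set X \<or> a \<in> set Y" using a that by auto
    ultimately have "conn X \<or> conn Y" unfolding conn_def using a(2) that(4) u v w by blast
    then show False using min that by fastforce
  qed
  have arcs: "b \<notin> set Z" if "b \<in> set L" "Z \<in> C" for b Z
  proof
    assume "b \<in> set Z"
    then obtain Z1 Z2 where Z: "Z = Z1 @ b # Z2" by (meson split_list)
    have wZ: "wlk s (Z1 @ b # Z2) t" using clq_walk[OF clq] that Z by auto
    then have "(Z1, b # Z2) \<in> pairs C (src b)" "(Z1 @ [b], Z2) \<in> pairs C (dst b)"
      using that Z by (auto simp: pairs_def walk_append)
    moreover obtain X Y where XY: "L = X @ b # Y" using \<open>b \<in> set L\<close> by (meson split_list)
    moreover have "wlk u X (src b)" "wlk u (X @ [b]) (dst b)" using walk XY by (auto simp: walk_append)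
    ultimately have "X = []" "Y = []"
      using interior[of X "b # Y" "src b"] interior[of "X @ [b]" Y "dst b"] by auto
    then show False using XY a that \<open>b \<in> set Z\<close> by auto
  qed
  have "L \<noteq> []" using a by auto
  then have sub: "\<not> set L \<subseteq> set Z" if "Z \<in> C" for Z
    using arcs[OF _ that] by (cases L) auto
  obtain A B1 where A: "(A, B1) \<in> pairs C u"
    "\<And>X Y. (X, Y) \<in> pairs C u \<Longrightarrow> ol Y L \<Longrightarrow> \<not> il A X"
    "\<And>X Y. (X, Y) \<in> pairs C u \<Longrightarrow> ol L Y \<Longrightarrow> \<not> il X A"
    using exists_in_walk[OF clq u] by blast
  obtain A1 B where B: "(A1, B) \<in> pairs C w"
    "\<And>X Y. (X, Y) \<in> pairs C w \<Longrightarrow> il X L \<Longrightarrow> \<not> ol B Y"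
    "\<And>X Y. (X, Y) \<in> pairs C w \<Longrightarrow> il L X \<Longrightarrow> \<not> ol Y B"
    using exists_out_walk[OF clq w] by blast
  have wA: "wlk s A u" and wB: "wlk w B t" and mem: "A @ B1 \<in> C" "A1 @ B \<in> C"
    using A(1) B(1) by (auto dest!: pairsD)
  \<comment> \<open>Strict comparisons make both parts of \<open>L\<close> nonempty, so a crossing
    within \<open>L\<close> would lead a route of \<open>C\<close> through an interior vertex of
    \<open>L\<close>.\<close>
  have no_L: False if "Z \<in> C" "Z = X @ Y" "L = X' @ Y'" "il X X' \<or> il X' X" "ol Y' Y \<or> ol Y Y'"
    for Z X Y X' Y'
  proof -
    have "wlk u (X' @ Y') w" using walk that(3) by simp
    then obtain v where v: "wlk u X' v" unfolding walk_append by blast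
    have "X' \<noteq> []" "Y' \<noteq> []" using that by auto
    then show False using interior[OF that(3) _ _ v] pairsI_il[OF clq, of X Y X' u v] that v by auto
  qed
  have "A @ L @ B \<in> C"
  proof (rule mclqI_mem[OF C])
    show "wlk s (A @ L @ B) t" using wA wB walk by (auto simp: walk_append)
    fix Z assume Z: "Z \<in> C"
    note no = clqD[OF clq mem(1) Z] clqD[OF clq mem(2) Z] clqD[OF clq Z mem(1)] clqD[OF clq Z mem(2)]
    show "\<not> cross (A @ L @ B) Z"
    proof
      assume "cross (A @ L @ B) Z"
      then show False
      proof (cases rule: cross_append_left)
        case 2
        then show ?thesis
        proof (cases rule: cross_append_left)
          case 1
          then show ?thesis using no_L[OF Z] unfolding cross_def by blast
        next
          case (3 X Y)
          then show False using B(3) pairsI_il[OF clq] Z walk by blast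
        qed (use no cross_extends in blast)
      next
        case (3 X Y)
        from 3(3) consider "ol Y L" | Y' where "Y = L @ Y'" using ol_append_left_cases by blast
        then show False
        proof cases
          case 1
          then show ?thesis using 3 A(2) pairsI_il[OF clq] Z wA by blast
        qed (use 3 sub[OF Z] in auto)
      qed (use no cross_extends in blast)
    qed
    show "\<not> cross Z (A @ L @ B)"
    proof
      assume "cross Z (A @ L @ B)"
      then show False
      proof (cases rule: cross_append_right)
        case 2
        then show ?thesis
        proof (cases rule: cross_append_right)
          case 1
          then show ?thesis using no_L[OF Z] unfolding cross_def by blast
        next
          case (3 X Y)
          then show False using B(2) pairsI_il[OF clq] Z walk by blast
        qed (use no cross_extends in blast)
      next
        case (3 X Y)
        from 3(3) consider "ol L Y" | Y' where "Y = L @ Y'" using ol_append_right_cases by blast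
        then show False
        proof cases
          case 1
          then show ?thesis using 3 A(3) pairsI_il[OF clq] Z wA by blast
        qed (use 3 sub[OF Z] in auto)
      qed (use no cross_extends in blast)
    qed
  qed
  from sub[OF this] show False by auto
qed

lemma arc_used_pairs:
  assumes "mclq C" "e \<in> E"
  obtains K M where "(K @ [e], M) \<in> pairs C (dst e)"
proof -
  obtain R where R: "R \<in> C" "e \<in> set R" using arc_used[OF assms] by blast
  then obtain X Y where "R = X @ e # Y" by (meson split_list)
  moreover have "wlk s R t" using clq_walk mclq_clq assms R by blast
  ultimately have "(X @ [e], Y) \<in> pairs C (dst e)" using R by (auto simp: pairs_def walk_append)
  then show thesis by (rule that)
qed

section \<open>Normal form and localisation of crossings\<close>

lemma cross_iff:
  "cross P Q \<longleftrightarrow> (\<exists>P1 e S g P2 Q1 f h Q2. P = P1 @ e # S @ g # P2 \<and> Q = Q1 @ f # S @ h # Q2 \<and>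
     ri e f \<and> ro h g)"
proof
  assume "cross P Q"
  then obtain A B A' B' where *: "P = A @ B" "Q = A' @ B'" "il A A'" "ol B' B"
    unfolding cross_def by blast
  obtain A1 A1' e f S1 where 1: "A = A1 @ e # S1" "A' = A1' @ f # S1" "ri e f"
    using * il_iff by blast
  obtain B1 B1' h g S2 where 2: "B' = S2 @ h # B1'" "B = S2 @ g # B1" "ro h g"
    using * ol_iff by blast
  have "P = A1 @ e # (S1 @ S2) @ g # B1" "Q = A1' @ f # (S1 @ S2) @ h # B1'"
    using * 1 2 by simp_all
  then show "\<exists>P1 e S g P2 Q1 f h Q2. P = P1 @ e # S @ g # P2 \<and> Q = Q1 @ f # S @ h # Q2 \<and>
     ri e f \<and> ro h g"
    using 1 2 by blast
next
  assume "\<exists>P1 e S g P2 Q1 f h Q2. P = P1 @ e # S @ g # P2 \<and> Q = Q1 @ f # S @ h # Q2 \<and>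
     ri e f \<and> ro h g"
  then obtain P1 e S g P2 Q1 f h Q2 where
    "P = P1 @ e # S @ g # P2" "Q = Q1 @ f # S @ h # Q2" "ri e f" "ro h g" by blast
  then show "cross P Q"
    using crossI[of "P1 @ e # S" "Q1 @ f # S" "h # Q2" "g # P2"] by simp
qed

text \<open>\<open>A\<close> lies before \<open>u\<close> and \<open>B\<close> after it. Both paths
  continue beyond the splitting vertex of a crossing, which for \<open>A\<close> must then lie
  strictly before \<open>u\<close>.\<close>

lemma cross_rank:
  assumes "wlk s A u" "wlk u B t"
  shows "\<not> cross A B \<and> \<not> cross B A"
proof -
  have False if "A = X @ Y" "B = X' @ Y'" "il X X' \<or> il X' X" "Y \<noteq> []" for X Y X' Y'
  proof -
    have "wlk s (X @ Y) u" using assms(1) that(1) by simp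
    then obtain v where v: "wlk s X v" "wlk v Y u" unfolding walk_append by blast
    then have "wlk u X' v" using il_walk[of X' X u Y' t s v] assms(2) that by auto
    then have "rank u \<le> rank v" using walk_rank by blast
    moreover have "rank v < rank u" using walk_rank v that by blast
    ultimately show False by simp
  qed
  then show ?thesis unfolding cross_def by fastforce
qed

text \<open>As \<open>Y\<close> begins at \<open>u\<close>, it cannot meet \<open>A\<close> in a
  crossing, and a crossing split at \<open>u\<close> itself would need an arc of \<open>Y\<close>
  that enters \<open>u\<close>.\<close>

lemma cross_tail:
  assumes "wlk s A u" "wlk u B t" "wlk u Y t"
  shows "cross (A @ B) Y \<Longrightarrow> cross B Y" "cross Y (A @ B) \<Longrightarrow> cross Y B"
proof -
  have no: False if "Y = U @ V" "il A U \<or> il U A" for U V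
  proof -
    have "wlk u U u" using il_walk[of U A u V t s u] that assms by auto
    then have "U = []" by (rule closed_walk_Nil)
    then show False using that by auto
  qed
  show "cross (A @ B) Y \<Longrightarrow> cross B Y"
    by (erule cross_append_left) (use cross_rank[OF assms(1,3)] no in blast)+
  show "cross Y (A @ B) \<Longrightarrow> cross Y B"
    by (erule cross_append_right) (use cross_rank[OF assms(1,3)] no in blast)+
qed

lemma cross_init:
  assumes "wlk s A u" "wlk u B t" "wlk s X u"
  shows "cross (A @ B) X \<Longrightarrow> cross A X" "cross X (A @ B) \<Longrightarrow> cross X A"
proof -
  have no: False if "X = U @ V" "il A U \<or> il U A" "ol B V \<or> ol V B" for U V
  proof -
    have "wlk u V u" using il_walk[of U A s V u s u] that assms by auto
    then have "V = []" by (rule closed_walk_Nil)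
    then show False using that by auto
  qed
  show "cross (A @ B) X \<Longrightarrow> cross A X"
    by (erule cross_append_left) (use cross_rank[OF assms(3,2)] no in blast)+
  show "cross X (A @ B) \<Longrightarrow> cross X A"
    by (erule cross_append_right) (use cross_rank[OF assms(3,2)] no in blast)+
qed

section \<open>The relation \<open>cw_from\<close> on maximal cliques is a partial order\<close>

text \<open>A one-sided form of the clockwise condition: as the order on entering paths is
  asymmetric, being coherent or clockwise below at a vertex amounts to not being clockwise above
  there.\<close>

definition cwf :: "'e list set \<Rightarrow> 'e list set \<Rightarrow> bool" where
  "cwf C C' \<longleftrightarrow> (\<forall>R\<in>C. \<forall>R'\<in>C'. \<not> cross R' R)"

lemma cwfD: "cwf C C' \<Longrightarrow> R \<in> C \<Longrightarrow> R' \<in> C' \<Longrightarrow> \<not> cross R' R"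
  by (simp add: cwf_def)

lemma cwf_antisym:
  assumes "mclq C" "mclq C'" "cwf C C'" "cwf C' C"
  shows "C = C'"
proof -
  have "C \<subseteq> C'" using assms clq_walk[OF mclq_clq[OF assms(1)]]
    by (meson cwfD mclqI_mem subsetI)
  moreover have "C' \<subseteq> C" using assms clq_walk[OF mclq_clq[OF assms(2)]]
    by (meson cwfD mclqI_mem subsetI)
  ultimately show ?thesis by blast
qed

text \<open>Suppose that \<open>R''\<close> and \<open>R\<close> cross, and let \<open>v\<close> be the first vertex of their common
  segment there. All pairs of \<open>C2\<close> at \<open>v\<close> lie below \<open>(p1, q1)\<close> or above \<open>(p2, q2)\<close>, and
  since \<open>C2\<close> uses the arcs \<open>e\<close> and \<open>f\<close>, both kinds occur. This contradicts \<open>staircase\<close>.\<close>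

lemma cwf_trans:
  assumes C1: "clq C1" and C2: "mclq C2" and C3: "clq C3" and 12: "cwf C1 C2" and 23: "cwf C2 C3"
  shows "cwf C1 C3"
  unfolding cwf_def
proof (intro ballI notI)
  fix R R'' assume R: "R \<in> C1" "R'' \<in> C3" "cross R'' R"
  then obtain P1 e S g P2 Q1 f h Q2 where dec: "R'' = P1 @ e # S @ g # P2" "R = Q1 @ f # S @ h # Q2"
    "ri e f" "ro h g" unfolding cross_iff by blast
  define p1 q2 p2 q1 v where "p1 = P1 @ [e]" "q2 = S @ g # P2" "p2 = Q1 @ [f]" "q1 = S @ h # Q2"
    "v = dst e"
  note defs = this
  have R_eq: "R'' = p1 @ q2" "R = p2 @ q1" using dec defs by auto
  have less: "il p1 p2" "ol q1 q2" using dec defs by auto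
  have wR: "wlk s R t" "wlk s R'' t" using R C1 C3 clq_walk by auto
  then have E: "e \<in> E" "f \<in> E" "dst f = v" using dec defs ri_dst by (auto simp: walk_append)
  have w: "wlk s p1 v" "wlk v q2 t" "wlk s p2 v" "wlk v q1 t"
    using wR dec defs E by (auto simp: walk_append)
  define Lo Hi where "Lo = {x \<in> pairs C2 v. ple x (p1, q1)}" "Hi = {x \<in> pairs C2 v. ple (p2, q2) x}"
  note LoHi = this
  have un: "Lo \<union> Hi = pairs C2 v"
  proof -
    have "(X, Y) \<in> Lo \<union> Hi" if XY: "(X, Y) \<in> pairs C2 v" for X Y
    proof -
      note XYD = pairsD[OF XY]
      have "\<not> (il X p2 \<and> ol q1 Y)" "\<not> (il p1 X \<and> ol Y q2)"
        using cwfD[OF 12 R(1), of "X @ Y"] cwfD[OF 23 _ R(2), of "X @ Y"] XYD R_eq crossI by blast+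
      note no = this
      show ?thesis
      \<comment> \<open>For \<open>X\<close> below \<open>p2\<close>, the route \<open>R\<close>
        forces \<open>Y\<close> to be at most \<open>q1\<close>, which is below \<open>q2\<close>,
        and then \<open>R''\<close> forces \<open>X\<close> to be at most \<open>p1\<close>.
        Otherwise \<open>X\<close> is above \<open>p1\<close>, and \<open>R''\<close> alone forces
        \<open>Y\<close> to be at least \<open>q2\<close>.\<close>
      proof (cases "il X p2")
        case True
        then have Y: "Y = q1 \<or> ol Y q1" using no ol_total XYD w by blast
        then have "ol Y q2" using less ol_trans by blast
        then have "X = p1 \<or> il X p1" using no il_total XYD w by blast
        then show ?thesis using XY Y unfolding LoHi by auto
      next
        case False
        then have X: "p2 = X \<or> il p2 X" using il_total XYD w by blast
        then have "il p1 X" using less il_trans by blast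
        then have "q2 = Y \<or> ol q2 Y" using no ol_total XYD w by blast
        then show ?thesis using XY X unfolding LoHi by auto
      qed
    qed
    then have "pairs C2 v \<subseteq> Lo \<union> Hi" by (rule subrelI)
    then show ?thesis unfolding LoHi by blast
  qed
  obtain K M where 1: "(K @ [e], M) \<in> pairs C2 v" using arc_used_pairs[OF C2 E(1)] defs by metis
  have "il (K @ [e]) p2" using dec defs by simp
  then have "(K @ [e], M) \<notin> Hi" using il_asym unfolding LoHi by auto
  then have neLo: "Lo \<noteq> {}" using un 1 by auto
  obtain K M where 2: "(K @ [f], M) \<in> pairs C2 v" using arc_used_pairs[OF C2 E(2)] E by metis
  have "il p1 (K @ [f])" using dec defs by simp
  then have "(K @ [f], M) \<notin> Lo" using il_asym unfolding LoHi by auto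
  then have neHi: "Hi \<noteq> {}" using un 2 by auto
  show False
  proof (rule staircase[OF C2 un neLo neHi])
    have "ple (p1, q1) (p2, q2)" using less by simp
    then show "ple x y" if "x \<in> Lo" "y \<in> Hi" for x y
      using that ple_trans unfolding LoHi by blast
    fix A B A' B' assume "(A, B) \<in> Lo" "(A', B') \<in> Hi" "A = A' \<or> B = B'"
    then have "A = p1 \<or> il A p1" "B = q1 \<or> ol B q1" "A' = p2 \<or> il p2 A'" "B' = q2 \<or> ol q2 B'"
      unfolding LoHi by auto
    then have "il A A'" "ol B B'" using less il_trans ol_trans by blast+
    then show False using \<open>A = A' \<or> B = B'\<close> by auto
  qed
qed

lemma ple_antisym: "ple x y \<Longrightarrow> ple y x \<Longrightarrow> x = y"
  using il_asym ol_asym unfolding ple_def by (metis prod.expand)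

text \<open>If \<open>R = p @ q\<close> and \<open>R' = p' @ q'\<close> cross at \<open>u\<close>, comparing the staircases of \<open>C\<close> and \<open>C'\<close>
  at \<open>u\<close> shows that the route \<open>p' @ q\<close> is common to both cliques. A crossing of \<open>R\<close> and \<open>R'\<close>
  in the opposite sense would be one of \<open>p' @ q\<close> with \<open>R\<close> or \<open>R'\<close>.\<close>

lemma exchange_cwf:
  assumes C: "mclq C" and C': "mclq C'" and R: "R \<in> C" and C'_eq: "C' = C - {R} \<union> {R'}"
    and cr: "cross R R'"
  shows "cwf C C'"
proof -
  note clq = mclq_clq[OF C] and clq' = mclq_clq[OF C']
  obtain P1 e S g P2 Q1 f h Q2 where dec: "R = P1 @ e # S @ g # P2" "R' = Q1 @ f # S @ h # Q2"
    "ri e f" "ro h g" using cr unfolding cross_iff by blast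
  define p q p' q' u where "p = P1 @ [e]" "q = S @ g # P2" "p' = Q1 @ [f]" "q' = S @ h # Q2"
    "u = dst e"
  note defs = this
  have R_eq: "R = p @ q" "R' = p' @ q'" using dec defs by auto
  have less: "il p p'" "ol q' q" using dec defs by auto
  have wR: "wlk s R t" "wlk s R' t" using R C'_eq clq_walk clq clq' by auto
  then have E: "e \<in> E" "f \<in> E" "dst f = u" using dec defs ri_dst by (auto simp: walk_append)
  have w: "wlk s p u" "wlk u q t" "wlk s p' u" "wlk u q' t"
    using wR dec defs E by (auto simp: walk_append)
  have pq: "(p, q) \<in> pairs C u" "(p', q') \<in> pairs C' u"
    using w R_eq R C'_eq by (auto simp: pairs_def)
  have CC': "(A, B) \<in> pairs C' u" if AB: "(A, B) \<in> pairs C u" "(A, B) \<noteq> (p, q)" for A B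
    using split_unique[of A B p q s u] AB w R_eq C'_eq by (auto simp: pairs_def)
  have C'C: "(A, B) \<in> pairs C u" if AB: "(A, B) \<in> pairs C' u" "(A, B) \<noteq> (p', q')" for A B
    using split_unique[of A B p' q' s u] AB w R_eq C'_eq by (auto simp: pairs_def)
  \<comment> \<open>\<open>(p', q)\<close> is the join of \<open>(p, q)\<close> and
    \<open>(p', q')\<close> in the product order. The pairs above it turn out to be common to both
    cliques.\<close>
  define Lo Hi Lo' where "Lo = {x \<in> pairs C u. ple x (p, q)}" "Hi = {x \<in> pairs C u. ple (p', q) x}"
    "Lo' = {x \<in> pairs C' u. ple x (p', q')}"
  note LoHi = this
  have un: "Lo \<union> Hi = pairs C u"
  proof -
    have "(X, Y) \<in> Lo \<union> Hi" if XY: "(X, Y) \<in> pairs C u" for X Y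
    proof (cases "(X, Y) = (p, q)")
      case False
      show ?thesis
      proof (cases "ple (X, Y) (p, q)")
        case f: False
        then have X: "ple (p, q) (X, Y)" using pairs_total[OF clq XY pq(1)] by blast
        then have "ol q' Y" using less ol_trans by auto
        then have "\<not> ple (X, Y) (p', q')" using ol_asym by auto
        then have "ple (p', q') (X, Y)" using pairs_total[OF clq' CC'[OF XY False] pq(2)] by blast
        then show ?thesis using X XY unfolding LoHi by auto
      qed (use XY LoHi in auto)
    qed (use pq LoHi in auto)
    then have "pairs C u \<subseteq> Lo \<union> Hi" by (rule subrelI)
    then show ?thesis unfolding LoHi by blast
  qed
  have no: "x \<noteq> (p, q) \<and> x \<noteq> (p', q')" if "x \<in> Hi" for x
    using that less il_asym ol_asym unfolding LoHi by auto
  have un': "Lo' \<union> Hi = pairs C' u"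
  proof -
    have "(X, Y) \<in> Lo' \<union> Hi" if XY: "(X, Y) \<in> pairs C' u" for X Y
    proof (cases "(X, Y) = (p', q') \<or> (X, Y) \<in> Hi")
      case False
      then have "ple (X, Y) (p, q)" using C'C[OF XY] un unfolding LoHi by blast
      then have "il X p'" using less il_trans by auto
      then have "\<not> ple (p', q') (X, Y)" using il_asym by auto
      then show ?thesis using pairs_total[OF clq' XY pq(2)] XY unfolding LoHi by blast
    qed (use XY LoHi in auto)
    then have "pairs C' u \<subseteq> Lo' \<union> Hi" by (rule subrelI)
    moreover have "Hi \<subseteq> pairs C' u"
      using CC' no unfolding LoHi by (metis (no_types, lifting) mem_Collect_eq subrelI)
    ultimately show ?thesis unfolding LoHi by blast
  qed
  obtain K M where K: "(K @ [f], M) \<in> pairs C u" using arc_used_pairs[OF C E(2)] E by metis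
  moreover have "il p (K @ [f])" using dec defs by simp
  ultimately have neHi: "Hi \<noteq> {}" using un il_asym unfolding LoHi by fastforce
  have neLo: "Lo \<noteq> {}" "Lo' \<noteq> {}" using pq unfolding LoHi by auto
  have le: "ple x y" if "x \<in> Lo" "y \<in> Hi" for x y
  proof -
    have "ple (p, q) (p', q)" using less by simp
    then show ?thesis using that ple_trans unfolding LoHi by blast
  qed
  have le': "ple x y" if "x \<in> Lo'" "y \<in> Hi" for x y
  proof -
    have "ple (p', q') (p', q)" using less by simp
    then show ?thesis using that ple_trans unfolding LoHi by blast
  qed
  obtain A B A1 B1 where 1: "(A, B) \<in> Lo" "(A1, B1) \<in> Hi" "\<And>x. x \<in> Lo \<Longrightarrow> ple x (A, B)"
    "\<And>y. y \<in> Hi \<Longrightarrow> ple (A1, B1) y" "A = A1 \<or> B = B1"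
    using staircase[OF C un neLo(1) neHi le] by blast
  obtain A' B' A2 B2 where 2: "(A', B') \<in> Lo'" "(A2, B2) \<in> Hi" "\<And>x. x \<in> Lo' \<Longrightarrow> ple x (A', B')"
    "\<And>y. y \<in> Hi \<Longrightarrow> ple (A2, B2) y" "A' = A2 \<or> B' = B2"
    using staircase[OF C' un' neLo(2) neHi le'] by blast
  have "(p, q) \<in> Lo" "(p', q') \<in> Lo'" using pq unfolding LoHi by simp_all
  then have "ple (p, q) (A, B)" "ple (p', q') (A', B')" using 1(3) 2(3) by blast+
  moreover have "ple (A, B) (p, q)" "ple (A', B') (p', q')" using 1(1) 2(1) unfolding LoHi by blast+
  ultimately have "(A, B) = (p, q)" "(A', B') = (p', q')" using ple_antisym by metis+
  moreover have "A1 \<noteq> p" using 1(2) less il_asym unfolding LoHi by auto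
  moreover have "B2 \<noteq> q'" using 2(2) less ol_asym unfolding LoHi by auto
  \<comment> \<open>The smallest pair of \<open>Hi\<close> shares a coordinate with
    \<open>(p, q)\<close> and one with \<open>(p', q')\<close>. As its first coordinate is not
    \<open>p\<close> and its second is not \<open>q'\<close>, it is \<open>(p', q)\<close>.\<close>
  moreover have "(A1, B1) = (A2, B2)" using 1(2,4) 2(2,4) ple_antisym by blast
  ultimately have p'q: "(p', q) \<in> Hi" using 1(2,5) 2(5) by auto
  then have mem: "p' @ q \<in> C" "p' @ q \<in> C'" using un un' by (auto dest!: pairsD)
  have "\<not> cross R' R"
  proof
    assume "cross R' R"
    then have "cross (p' @ q') (p @ q)" using R_eq by simp
    then show False
    proof (cases rule: cross_append_right)
      case 1
      then have "cross p' p" using cross_init(1)[OF w(3,4,1)] by blast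
      then show False using clqD[OF clq mem(1) R] R_eq cross_extends by blast
    next
      case 2
      then show False using clqD[OF clq' _ mem(2), of R'] C'_eq R_eq cross_extends by blast
    next
      case (3 X Y)
      then have "wlk s X u" using il_walk[of X p s Y t s u] w wR R_eq by metis
      then have "X = p'" using split_unique[of p' q' X Y s u] 3 w by auto
      then show False using 3 less il_asym by blast
    qed
  qed
  then show ?thesis
    using clqD[OF clq] clqD[OF clq'] unfolding cwf_def C'_eq by blast
qed

section \<open>Exchanging a route at a corner of the staircase\<close>

text \<open>The last conjunct makes the three pairs consecutive in the chain of \<open>C\<close> at
  \<open>u\<close>; the fourth combination \<open>p' @ q'\<close> is the route to be exchanged for
  \<open>p @ q\<close>.\<close>

definition corner ::
  "'e list set \<Rightarrow> 'v \<Rightarrow> 'e list \<Rightarrow> 'e list \<Rightarrow> 'e list \<Rightarrow> 'e list \<Rightarrow> bool" where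
  "corner C u p q p' q' \<longleftrightarrow> (p, q) \<in> pairs C u \<and> (p, q') \<in> pairs C u \<and> (p', q) \<in> pairs C u \<and>
     il p p' \<and> ol q' q \<and> (\<forall>x\<in>pairs C u. ple x (p, q') \<or> x = (p, q) \<or> ple (p', q) x)"

lemma cornerD:
  assumes "corner C u p q p' q'"
  shows "(p, q) \<in> pairs C u" "(p, q') \<in> pairs C u" "(p', q) \<in> pairs C u" "il p p'" "ol q' q"
    "x \<in> pairs C u \<Longrightarrow> ple x (p, q') \<or> x = (p, q) \<or> ple (p', q) x"
  using assms unfolding corner_def by blast+

lemma corner_cases:
  assumes "corner C u p q p' q'" "(X, Y) \<in> pairs C u"
  obtains "X = p \<or> il X p" "Y = q' \<or> ol Y q'" | "X = p" "Y = q" | "p' = X \<or> il p' X" "q = Y \<or> ol q Y"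
  using cornerD(6)[OF assms] by auto

lemma corner_between:
  assumes "corner C u p q p' q'" "(X, Y) \<in> pairs C u"
  shows "\<not> (il p X \<and> il X p')" "\<not> (ol q' Y \<and> ol Y q)"
  using cornerD(6)[OF assms] il_asym ol_asym by auto

text \<open>A route coherent with the new clique but missing from it must cross
  \<open>p @ q\<close>, and does so at \<open>u\<close>, with a first part \<open>x\<close> above
  \<open>p\<close> and at most \<open>p'\<close>, and a second part \<open>y\<close> below
  \<open>q\<close> and at least \<open>q'\<close>. As not both \<open>p'\<close> and
  \<open>q'\<close> are attained, \<open>(p, y)\<close> or \<open>(x, q)\<close> turns out to be a
  pair of \<open>C\<close> strictly between consecutive pairs of the corner.\<close>

lemma corner_exchange:
  assumes C: "mclq C" and cor: "corner C u p q p' q'"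
  shows "mclq (C - {p @ q} \<union> {p' @ q'})"
proof -
  note clq = mclq_clq[OF C]
  note cd = cornerD[OF cor]
  define C1 where "C1 = C - {p @ q} \<union> {p' @ q'}"
  have w: "wlk s p u" "wlk u q t" "wlk s p' u" "wlk u q' t"
    and mem: "p @ q \<in> C" "p @ q' \<in> C" "p' @ q \<in> C"
    using cd(1-3) by (auto dest!: pairsD)
  have wpq: "wlk s (p' @ q') t" using w by (auto simp: walk_append)
  have "p \<noteq> p'" "q \<noteq> q'" using cd(4,5) by auto
  then have mem1: "p @ q' \<in> C1" "p' @ q \<in> C1" "p' @ q' \<in> C1"
    using mem split_unique[of p' q p q s u] w unfolding C1_def by auto
  have coh: "\<not> cross V (p' @ q') \<and> \<not> cross (p' @ q') V" if V: "V \<in> C" "V \<noteq> p @ q" for V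
  proof -
    have no: False if "V = X @ Y" "il X p' \<and> ol q' Y \<or> il p' X \<and> ol Y q'" for X Y
    proof -
      have "(X, Y) \<in> pairs C u" using pairsI_il[OF clq, of X Y p' s u] that V w by blast
      moreover have "(X, Y) \<noteq> (p, q)" using V that by auto
      ultimately have "ple (X, Y) (p, q') \<or> ple (p', q) (X, Y)" using cd(6) by blast
      then show False
      proof
        assume "ple (X, Y) (p, q')"
        then have "il X p'" "\<not> ol q' Y" using cd(4) il_trans ol_asym by auto
        then show False using that(2) il_asym by blast
      next
        assume "ple (p', q) (X, Y)"
        then have "\<not> il X p'" "ol q' Y" using cd(5) ol_trans il_asym by auto
        then show False using that(2) ol_asym by blast
      qed
    qed
    have V_parts: "\<not> cross V p'" "\<not> cross V q'" "\<not> cross p' V" "\<not> cross q' V"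
      using not_cross_append clqD[OF clq V(1) mem(2)] clqD[OF clq mem(2) V(1)]
        clqD[OF clq V(1) mem(3)] clqD[OF clq mem(3) V(1)] by blast+
    have "\<not> cross V (p' @ q')"
    proof
      assume "cross V (p' @ q')"
      then show False
        by (rule cross_append_right) (use no V_parts in blast)+
    qed
    moreover have "\<not> cross (p' @ q') V"
    proof
      assume "cross (p' @ q') V"
      then show False
        by (rule cross_append_left) (use no V_parts in blast)+
    qed
    ultimately show ?thesis by blast
  qed
  have clq1: "clq C1"
    unfolding clq_def C1_def using coh clq_walk[OF clq] clqD[OF clq] wpq no_self_cross[OF wpq] by blast
  moreover have "Z \<in> C1" if Z: "wlk s Z t" "\<forall>V\<in>C1. \<not> cross Z V \<and> \<not> cross V Z" for Z
  proof (rule ccontr)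
    assume Z_notin: "Z \<notin> C1"
    have Zco: "\<not> cross Z V" "\<not> cross V Z" if "V \<in> C1" for V using Z(2) that by auto
    have parts: "\<not> cross Z p" "\<not> cross p Z" "\<not> cross Z q" "\<not> cross q Z"
      "\<not> cross Z p'" "\<not> cross p' Z" "\<not> cross Z q'" "\<not> cross q' Z"
      using not_cross_append Zco[OF mem1(1)] Zco[OF mem1(2)] by blast+
    have "cross Z (p @ q) \<or> cross (p @ q) Z"
    proof (rule ccontr)
      assume no: "\<not> ?thesis"
      then have "\<forall>V\<in>C. \<not> cross Z V \<and> \<not> cross V Z" using Zco unfolding C1_def by blast
      then have "Z \<in> C" using mclqI_mem[OF C Z(1)] by blast
      then have "Z = p @ q" using Z_notin unfolding C1_def by blast
      then show False using crossI[OF cd(4,5)] Zco(1)[OF mem1(3)] by simp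
    qed
    \<comment> \<open>Neither \<open>p\<close> nor \<open>q\<close> alone is involved in a crossing
      with \<open>Z\<close>, so the crossing splits at \<open>u\<close>.\<close>
    then obtain x y where xy: "Z = x @ y" "il x p \<and> ol q y \<or> il p x \<and> ol y q"
    proof
      assume "cross Z (p @ q)"
      then show thesis
        by (rule cross_append_right) (use parts that in blast)+
    next
      assume "cross (p @ q) Z"
      then show thesis
        by (rule cross_append_left) (use parts that in blast)+
    qed
    have wxy: "wlk s x u" "wlk u y t" using il_walk[of x p s y t s u] xy Z w by blast+
    have no: "\<not> (il x p \<and> ol q' y)" "\<not> (il x p' \<and> ol q' y)" "\<not> (il p' x \<and> ol y q)"
      using crossI[of x p q' y] crossI[of x p' q' y] crossI[of p' x y q] Zco[OF mem1(1)]
        Zco[OF mem1(2)] Zco[OF mem1(3)] xy(1) by blast+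
    have lt: "il p x" "ol y q" using xy(2) no(1) cd(5) ol_trans by blast+
    have le: "x = p' \<or> il x p'" "y = q' \<or> ol q' y"
      using no lt il_total[OF wxy(1) w(3)] ol_total[OF wxy(2) w(4)]
        crossI[of p x y q'] Zco(2)[OF mem1(1)] xy(1) by blast+
    have neq: "\<not> (x = p' \<and> y = q')" using Z_notin mem1 xy by auto
    have cross_xy: "\<not> cross V x \<and> \<not> cross x V \<and> \<not> cross V y \<and> \<not> cross y V" if "V \<in> C1" for V
      using Zco[OF that] xy(1) not_cross_append by blast
    have pq_parts: "\<not> cross V p \<and> \<not> cross p V \<and> \<not> cross V q \<and> \<not> cross q V" if "V \<in> C" for V
      using clqD[OF clq that mem(1)] clqD[OF clq mem(1) that] not_cross_append by blast
    show False
    proof (cases "x = p'")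
      case True
      then have y: "ol q' y" using le neq by blast
      have "(p, y) \<in> pairs C u"
      proof (rule coherent_mem[OF C _ w(1)])
        show "wlk s (p @ y) t" using w wxy by (auto simp: walk_append)
        fix V assume V: "V \<in> C"
        \<comment> \<open>Coherence of \<open>Z\<close> with the new clique says nothing about the
          removed route. A crossing with it would already be one with its part \<open>q\<close>,
          which also lies on \<open>p' @ q\<close>.\<close>
        have "\<not> cross V y \<and> \<not> cross y V"
        proof (cases "V = p @ q")
          case True
          have "\<not> cross q y" "\<not> cross y q" using parts(3,4) xy(1) cross_extends by blast+
          then show ?thesis using True cross_tail[OF w(1,2) wxy(2)] by blast
        next
          case False
          then show ?thesis using V cross_xy unfolding C1_def by blast
        qed
        then show "\<not> cross V p \<and> \<not> cross p V \<and> \<not> cross V y \<and> \<not> cross y V"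
          using pq_parts[OF V] by blast
      next
        fix X Y assume "(X, Y) \<in> pairs C u"
        with cor show "\<not> (il X p \<and> ol y Y) \<and> \<not> (il p X \<and> ol Y y)"
        proof (cases rule: corner_cases)
          case 1
          then have "ol Y y" "\<not> il p X" using y ol_trans il_asym by auto
          then show ?thesis using ol_asym by blast
        next
          case 3
          then have "ol y Y" "\<not> il X p" using lt cd(4) ol_trans il_trans il_asym by blast+
          then show ?thesis using ol_asym by blast
        qed simp
      qed
      then show False using corner_between(2)[OF cor] y lt by blast
    next
      case False
      then have x: "il x p'" using le by blast
      then have y: "y = q'" using no le by blast
      have "(x, q) \<in> pairs C u"
      proof (rule coherent_mem[OF C _ wxy(1)])
        show "wlk s (x @ q) t" using w wxy by (auto simp: walk_append)
        fix V assume V: "V \<in> C"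
        have "\<not> cross V x \<and> \<not> cross x V"
        proof (cases "V = p @ q")
          case True
          have "\<not> cross p x" "\<not> cross x p" using parts(1,2) xy(1) cross_extends by blast+
          then show ?thesis using True cross_init[OF w(1,2) wxy(1)] by blast
        next
          case False
          then show ?thesis using V cross_xy unfolding C1_def by blast
        qed
        then show "\<not> cross V x \<and> \<not> cross x V \<and> \<not> cross V q \<and> \<not> cross q V"
          using pq_parts[OF V] by blast
      next
        fix X Y assume "(X, Y) \<in> pairs C u"
        with cor show "\<not> (il X x \<and> ol q Y) \<and> \<not> (il x X \<and> ol Y q)"
        proof (cases rule: corner_cases)
          case 1
          then have "il X x" "\<not> ol q Y" using lt cd(5) ol_trans il_trans ol_asym by blast+
          then show ?thesis using il_asym by blast
        next
          case 3
          then have "il x X" "\<not> ol Y q" using x il_trans ol_asym by auto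
          then show ?thesis using il_asym by blast
        qed simp
      qed
      then show False using corner_between(1)[OF cor] x lt by blast
    qed
  qed
  ultimately show ?thesis unfolding mclq_def C1_def by blast
qed

lemma append_Cons_eq_cases:
  assumes "A @ a # B = A' @ a' # B'"
  obtains "A = A'" "a = a'" "B = B'" | U where "A' = A @ a # U" "B = U @ a' # B'"
    | U where "A = A' @ a' # U" "B' = U @ a # B"
  using assms by (auto simp: append_eq_append_conv2 Cons_eq_append_conv append_eq_Cons_conv)

text \<open>\<open>il [h] X\<close> says that \<open>X\<close> enters \<open>dst h\<close> by an arc
  after \<open>h\<close>, so the chain is cut between the arcs up to \<open>h\<close> and the later
  ones. The first coordinates differ across this cut, hence the second coordinate \<open>y\<close>
  is the shared one.\<close>

lemma staircase_in:
  assumes C: "mclq C" and h: "h \<in> E" and ex: "(A, B) \<in> pairs C (dst h)" "il [h] A"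
  obtains k y k' where "(k, y) \<in> pairs C (dst h)" "(k', y) \<in> pairs C (dst h)" "il k k'"
    "\<not> il [h] k" "il [h] k'"
    "\<And>X Y. (X, Y) \<in> pairs C (dst h) \<Longrightarrow> \<not> il [h] X \<Longrightarrow> ple (X, Y) (k, y)"
    "\<And>X Y. (X, Y) \<in> pairs C (dst h) \<Longrightarrow> il [h] X \<Longrightarrow> il k X \<and> ple (k', y) (X, Y)"
proof -
  note clq = mclq_clq[OF C]
  define Lo Hi where "Lo = {(X, Y) \<in> pairs C (dst h). \<not> il [h] X}"
    "Hi = {(X, Y) \<in> pairs C (dst h). il [h] X}"
  note LoHi = this
  have un: "Lo \<union> Hi = pairs C (dst h)" unfolding LoHi by auto
  obtain K M where K: "(K @ [h], M) \<in> pairs C (dst h)" using arc_used_pairs[OF C h] by blast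
  have "\<not> il [h] (K @ [h])" by simp
  then have ne: "Lo \<noteq> {}" "Hi \<noteq> {}" using K ex unfolding LoHi by auto
  have less: "il X X'" if "(X, Y) \<in> Lo" "(X', Y') \<in> Hi" for X Y X' Y'
  proof -
    have "il [h] X'" using that(2) unfolding LoHi by simp
    then obtain a' A' where X': "X' = A' @ [a']" "ri h a'"
      by (cases X' rule: rev_cases) auto
    have w: "wlk s X (dst h)" "\<not> il [h] X" using that(1) unfolding LoHi by (auto dest!: pairsD)
    have "wlk s (K @ [h]) (dst h)" using K by (auto dest!: pairsD)
    then have "s \<noteq> dst h" using closed_walk_Nil by fastforce
    then obtain a A where X: "X = A @ [a]" using w by (cases X rule: rev_cases) auto
    then have "a = h \<or> ri a h" using w ri_total[of a h] h by (auto simp: walk_append)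
    then show ?thesis using X X' ri_trans by (auto dest: transpD)
  qed
  have le: "ple x y" if "x \<in> Lo" "y \<in> Hi" for x y
  proof (cases x; cases y)
    fix X Y X' Y' assume "x = (X, Y)" "y = (X', Y')"
    then show ?thesis
      using less[of X Y X' Y'] pairs_il_imp_ple[OF clq, of X Y "dst h" X' Y'] that un by blast
  qed
  obtain k y k' y' where *: "(k, y) \<in> Lo" "(k', y') \<in> Hi" "\<And>x. x \<in> Lo \<Longrightarrow> ple x (k, y)"
    "\<And>x. x \<in> Hi \<Longrightarrow> ple (k', y') x" "k = k' \<or> y = y'"
    by (rule staircase[OF C un ne le]) blast+
  have "il k k'" using less * by blast
  then have "y' = y" using * by auto
  then show thesis
    using that[of k y k'] * less \<open>il k k'\<close> unfolding LoHi by (auto simp del: ple_simp)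
qed

text \<open>If the conclusion fails, \<open>x\<close> joins \<open>p'\<close> along an arc \<open>h\<close> at some other vertex \<open>w\<close>. If \<open>p\<close> passes through
  \<open>w\<close>, the order of \<open>p\<close>, \<open>x\<close> and \<open>p'\<close> or the fact that \<open>C\<close> uses \<open>h\<close> gives a contradiction;
  if \<open>p\<close> joins \<open>p'\<close> only after \<open>w\<close>, the staircase of \<open>C\<close> at \<open>w\<close> produces a route of \<open>C\<close> that
  is crossed by \<open>x @ y\<close>.\<close>

lemma corner_in_arc:
  assumes C: "mclq C" and cor: "corner C u (P @ e # S) q (P' @ e' # S) q'" and ee': "ri e e'"
    and wZ: "wlk s (x @ y) t" "wlk s x u" and nc: "\<And>Z. Z \<in> C \<Longrightarrow> \<not> cross (x @ y) Z"
    and le: "P @ e # S = x \<or> il (P @ e # S) x" and less: "il x (P' @ e' # S)"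
  shows "\<exists>X. x = X @ e # S"
proof (rule ccontr)
  assume neg: "\<not> ?thesis"
  define p p' where "p = P @ e # S" "p' = P' @ e' # S"
  note defs = this
  note clq = mclq_clq[OF C]
  note cor' = cor[folded defs]
  note cd = cornerD[OF cor']
  have px: "il p x" using le neg defs by auto
  have w: "wlk s p u" "wlk u q t" "wlk s p' u" "wlk u q' t"
    and mem: "p @ q \<in> C" "p @ q' \<in> C" "p' @ q \<in> C"
    using cd(1-3) by (auto dest!: pairsD)
  obtain X1 X2 h h' T where x: "x = X1 @ h # T" "p' = X2 @ h' # T" "ri h h'"
    using less il_iff unfolding defs by blast
  have hE: "h \<in> E" "dst h' = dst h" using wZ(2) x ri_dst by (auto simp: walk_append)
  have wT: "wlk (dst h) T u" using wZ(2) x by (auto simp: walk_append)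
  have "P' @ e' # S = X2 @ h' # T" using x defs by simp
  then show False
  proof (cases rule: append_Cons_eq_cases)
    case 1
    \<comment> \<open>Here \<open>h\<close> lies between \<open>e\<close> and \<open>e'\<close>. A
      pair of \<open>C\<close> entering by \<open>h\<close> is squeezed between two pairs with
      second coordinate \<open>S @ q\<close>, so it has the same one and yields a pair at
      \<open>u\<close> strictly between \<open>p\<close> and \<open>p'\<close>.\<close>
    have "dst e = dst h" using 1 ri_dst[OF ee'] hE by simp
    have "ri e h" using px x 1 defs neg by auto
    obtain K M where K: "(K @ [h], M) \<in> pairs C (dst h)" using arc_used_pairs[OF C hE(1)] by blast
    have "(P @ [e], S @ q) \<in> pairs C (dst h)" "(P' @ [e'], S @ q) \<in> pairs C (dst h)"
      using pairsI_il[OF clq, of "P @ [e]" "S @ q" "K @ [h]" s "dst h"]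
        pairsI_il[OF clq, of "P' @ [e']" "S @ q" "K @ [h]" s "dst h"] mem defs K \<open>ri e h\<close> x 1
      by (auto dest!: pairsD)
    then have "ple (P @ [e], S @ q) (K @ [h], M)" "ple (K @ [h], M) (P' @ [e'], S @ q)"
      using pairs_il_imp_ple[OF clq] K \<open>ri e h\<close> x 1 by simp_all
    then have "M = S @ q" using ol_asym by auto
    then have "(K @ h # S) @ q \<in> C" using K by (auto dest!: pairsD)
    moreover have between: "il p (K @ h # S)" "il (K @ h # S) p'" using defs \<open>ri e h\<close> x 1 by auto
    ultimately have "(K @ h # S, q) \<in> pairs C u" using pairsI_il[OF clq] w by blast
    then show False using corner_between(1)[OF cor'] between by blast
  next
    case (2 U)
    then have "il ((P @ e # U) @ h' # T) (X1 @ h # T)" using px x defs by simp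
    then show False unfolding il_Cons_append using x(3) ri_asym by auto
  next
    case (3 U)
    have p'q: "(X2 @ [h'], T @ q) \<in> pairs C (dst h)"
      using mem(3) x(2) w(3) hE by (intro pairsI[OF clq]) (auto simp: walk_append)
    have hh': "il [h] (X2 @ [h'])" using x(3) by simp
    obtain k z k' where st: "(k, z) \<in> pairs C (dst h)" "(k', z) \<in> pairs C (dst h)" "il k k'"
      "il [h] k'" "\<And>X Y. (X, Y) \<in> pairs C (dst h) \<Longrightarrow> il [h] X \<Longrightarrow> il k X \<and> ple (k', z) (X, Y)"
      by (rule staircase_in[OF C hE(1) p'q hh']) blast
    have z_le: "z = T @ q \<or> ol z (T @ q)" and k: "il k (X2 @ [h'])" using st(5)[OF p'q hh'] by auto
    \<comment> \<open>A route of \<open>C\<close> following \<open>k\<close> along \<open>T\<close>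
      would enter \<open>u\<close> strictly between \<open>p\<close> and \<open>p'\<close>. Hence
      \<open>z\<close> branches off below \<open>T\<close>, and \<open>x @ y\<close> crosses
      \<open>k' @ z\<close>.\<close>
    have z_T: False if z: "z = T @ z'" for z'
    proof -
      have "(k @ T) @ z' \<in> C" using st(1) z by (auto dest!: pairsD)
      moreover have "wlk s (k @ T) u" using st(1) wT by (auto dest!: pairsD simp: walk_append)
      ultimately have "(k @ T, z') \<in> pairs C u" using pairsI[OF clq] by blast
      moreover have "il p ((k @ U) @ e' # S)" using ee' unfolding defs il_Cons_append by blast
      then have "il p (k @ T)" using 3 by simp
      moreover have "il (k @ T) ((X2 @ [h']) @ T)" using k by (simp only: il_append)
      then have "il (k @ T) p'" using x(2) by simp
      ultimately show False using corner_between(1)[OF cor'] by blast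
    qed
    then have "ol z T" using z_le ol_append_left_cases by blast
    then have "ol z (T @ y)" using ol_extend[of z T "[]" y] by simp
    moreover have "il (X1 @ [h]) k'" using il_extend[OF st(4), of X1 "[]"] by simp
    ultimately have "cross ((X1 @ [h]) @ (T @ y)) (k' @ z)" by (intro crossI)
    moreover have "k' @ z \<in> C" using st(2) by (auto dest!: pairsD)
    ultimately show False using nc[of "k' @ z"] x by simp
  qed
qed

section \<open>Corners in the reversed graph\<close>

lemma reversal_walk: "walk E dst src u p v \<longleftrightarrow> wlk v (rev p) u"
  by (metis walk_rev rev_rev_ident)

lemma reversal_pairs:
  "(A, B) \<in> framed_dag.pairs E dst src t s (rev ` C) u \<longleftrightarrow> (rev B, rev A) \<in> pairs C u"
proof -
  have "A @ B \<in> rev ` C \<longleftrightarrow> rev B @ rev A \<in> C"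
    by (metis image_iff rev_append rev_rev_ident)
  then show ?thesis
    by (auto simp: framed_dag.pairs_def[OF reversal] pairs_def reversal_walk)
qed

lemma reversal_ple:
  "framed_dag.ple (\<lambda>e f. ro f e) (\<lambda>e f. ri f e) (A, B) (A', B') \<longleftrightarrow>
     ple (rev B', rev A') (rev B, rev A)"
  by (auto simp: framed_dag.ple_def[OF reversal] reversal_il reversal_ol)

lemma reversal_mclq:
  assumes "mclq C"
  shows "framed_dag.mclq E dst src t s (\<lambda>e f. ro f e) (\<lambda>e f. ri f e) (rev ` C)"
proof -
  have "R \<in> rev ` C" if "wlk s (rev R) t" "\<forall>Z\<in>C. \<not> cross (rev R) Z \<and> \<not> cross Z (rev R)" for R
    using mclqI_mem[OF assms, of "rev R"] that by (metis image_eqI rev_rev_ident)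
  then show ?thesis
    using mclq_clq[OF assms]
    by (auto simp: framed_dag.mclq_def[OF reversal] framed_dag.clq_def[OF reversal] clq_def
        reversal_walk reversal_cross)
qed

lemma reversal_corner:
  assumes "corner C u p q p' q'"
  shows "framed_dag.corner E dst src t s (\<lambda>e f. ro f e) (\<lambda>e f. ri f e) (rev ` C) u
    (rev q) (rev p) (rev q') (rev p')"
  using cornerD[OF assms]
  by (fastforce simp: framed_dag.corner_def[OF reversal] reversal_pairs reversal_il reversal_ol
      reversal_ple rev_swap simp del: ple_simp)

text \<open>In the reversed graph the second coordinate of the corner and \<open>y\<close> take the
  places of the first coordinate and \<open>x\<close>, and the claim becomes
  \<open>corner_in_arc\<close>.\<close>

lemma corner_out_arc:
  assumes C: "mclq C" and cor: "corner C u p (T @ g # Q) p' (T @ g' # Q')" and gg': "ro g' g"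
    and wZ: "wlk s (x @ y) t" "wlk s x u" and nc: "\<And>Z. Z \<in> C \<Longrightarrow> \<not> cross (x @ y) Z"
    and le: "y = T @ g # Q \<or> ol y (T @ g # Q)" and less: "ol (T @ g' # Q') y"
  shows "\<exists>Y. y = T @ g # Y"
proof -
  interpret rd: framed_dag E dst src t s "\<lambda>v. - rank v" "\<lambda>e f. ro f e" "\<lambda>e f. ri f e"
    by (rule reversal)
  have wy: "wlk u y t" using wZ by (auto simp: walk_append dest: walk_end_unique)
  have "\<exists>X. rev y = X @ g # rev T"
  proof (rule rd.corner_in_arc[OF reversal_mclq[OF C], of u "rev Q" g "rev T" "rev p" "rev Q'" g' "rev p'" "rev y" "rev x"])
    show "rd.corner (rev ` C) u (rev Q @ g # rev T) (rev p) (rev Q' @ g' # rev T) (rev p')"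
      using reversal_corner[OF cor] by simp
    show "\<not> rd.cross (rev y @ rev x) Z" if "Z \<in> rev ` C" for Z
      using nc that by (auto simp: reversal_cross)
  qed (use gg' wZ(1) wy le less in \<open>auto simp: reversal_walk reversal_il\<close>)
  then obtain X where "rev y = X @ g # rev T" by blast
  then have "rev (rev y) = rev (X @ g # rev T)" by simp
  then show ?thesis by auto
qed

text \<open>A route of \<open>C'\<close> crossing the new one in the wrong sense splits at
  \<open>u\<close> into \<open>x\<close> and \<open>y\<close>, where \<open>x\<close> must end in
  \<open>e # S\<close> and \<open>y\<close> must begin with \<open>T @ [g]\<close>. By
  \<open>neg\<close> the comparisons in \<open>less\<close> are decided on these very segments, so
  they also hold against \<open>x\<close> and \<open>y\<close>, and \<open>x @ y\<close> crosses
  \<open>r @ r'\<close> inside \<open>C'\<close>.\<close>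

lemma corner_exchange_cwf:
  assumes C: "mclq C" and C': "clq C'" and cw: "cwf C C'"
    and cor: "corner C u (P @ e # S) (T @ g # Q) (P' @ e' # S) (T @ g' # Q')"
    and arcs: "ri e e'" "ro g' g" and R: "(r, r') \<in> pairs C' u"
    and less: "il (P @ e # S) r" "ol r' (T @ g # Q)"
    and neg: "\<nexists>X. r = X @ e # S" "\<nexists>Y. r' = T @ g # Y"
  shows "cwf (C - {(P @ e # S) @ (T @ g # Q)} \<union> {(P' @ e' # S) @ (T @ g' # Q')}) C'"
proof -
  define p q p' q' where "p = P @ e # S" "q = T @ g # Q" "p' = P' @ e' # S" "q' = T @ g' # Q'"
  note defs = this
  note cd = cornerD[OF cor, folded defs]
  have w: "wlk s p u" "wlk u q t" "wlk s p' u" "wlk u q' t"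
    and mem: "p @ q \<in> C" "p @ q' \<in> C" "p' @ q \<in> C"
    using cd(1-3) by (auto dest!: pairsD)
  have "\<not> cross Z (p' @ q')" if Z: "Z \<in> C'" for Z
  proof
    note nc = cwfD[OF cw _ Z]
    have parts: "\<not> cross Z p'" "\<not> cross Z q'"
      using nc[OF mem(2)] nc[OF mem(3)] not_cross_append by blast+
    assume "cross Z (p' @ q')"
    then obtain x y where xy: "Z = x @ y" "il x p'" "ol q' y"
      by (rule cross_append_right) (use parts in blast)+
    have wZ: "wlk s (x @ y) t" using clq_walk[OF C' Z] xy by simp
    have wxy: "wlk s x u" "wlk u y t" using il_walk[of x p' s y t s u] xy wZ w by blast+
    have "\<not> il x p" using crossI[of x p q' y] nc[OF mem(2)] xy by blast
    then have x: "p = x \<or> il p x" using il_total w wxy by blast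
    have "\<not> ol q y" using crossI[of x p' q y] nc[OF mem(3)] xy by blast
    then have y: "y = q \<or> ol y q" using ol_total w wxy by blast
    obtain X where X: "x = X @ e # S"
      using corner_in_arc[OF C cor arcs(1) wZ wxy(1)] nc x xy unfolding defs by blast
    obtain Y where Y: "y = T @ g # Y"
      using corner_out_arc[OF C cor arcs(2) wZ wxy(1)] nc y xy unfolding defs by blast
    have "il (e # S) r" using less(1) neg(1) il_append_right_cases by blast
    then have "il x r" using X il_extend[of "e # S" r X "[]"] by simp
    moreover have "ol r' ((T @ [g]) @ Q)" using less(2) by simp
    then have "ol r' (T @ [g])" using neg(2) ol_append_left_cases[of r' "T @ [g]" Q] by auto
    then have "ol r' y" using Y ol_extend[of r' "T @ [g]" "[]" Y] by simp
    ultimately have "cross Z (r @ r')" using xy crossI by simp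
    then show False using clqD[OF C' Z, of "r @ r'"] R by (auto dest!: pairsD)
  qed
  then show ?thesis using cw unfolding cwf_def defs by auto
qed

section \<open>Corners at shortest crossings\<close>

lemma staircase_out:
  assumes C: "mclq C" and h: "h \<in> E" and ex: "(A, B) \<in> pairs C (src h)" "ol [h] B"
  obtains x m n where "(x, m) \<in> pairs C (src h)" "(x, n) \<in> pairs C (src h)" "ol m n"
    "\<not> ol [h] m" "ol [h] n"
    "\<And>X Y. (X, Y) \<in> pairs C (src h) \<Longrightarrow> ol [h] Y \<Longrightarrow> ple (x, n) (X, Y)"
proof -
  note clq = mclq_clq[OF C]
  define Lo Hi where "Lo = {(X, Y) \<in> pairs C (src h). \<not> ol [h] Y}"
    "Hi = {(X, Y) \<in> pairs C (src h). ol [h] Y}"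
  note LoHi = this
  have un: "Lo \<union> Hi = pairs C (src h)" unfolding LoHi by auto
  obtain K M where "(K @ [h], M) \<in> pairs C (dst h)" using arc_used_pairs[OF C h] by blast
  then have K: "(K, h # M) \<in> pairs C (src h)" by (auto simp: pairs_def walk_append)
  have "\<not> ol [h] (h # M)" by simp
  then have ne: "Lo \<noteq> {}" "Hi \<noteq> {}" using K ex unfolding LoHi by blast+
  have less: "ol Y Y'" if "(X, Y) \<in> Lo" "(X', Y') \<in> Hi" for X Y X' Y'
  proof -
    have "ol [h] Y'" using that(2) unfolding LoHi by simp
    then obtain a' A' where Y': "Y' = a' # A'" "ro h a'"
      by (cases Y') auto
    have w: "wlk (src h) Y t" "\<not> ol [h] Y" using that(1) unfolding LoHi by (auto dest!: pairsD)
    have "wlk (src h) (h # M) t" using K by (auto dest!: pairsD)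
    then have "src h \<noteq> t" using closed_walk_Nil by fastforce
    then obtain a A where Y: "Y = a # A" using w by (cases Y) auto
    then have "a = h \<or> ro a h" using w ro_total[of a h] h by auto
    then show ?thesis using Y Y' ro_trans by (auto dest: transpD)
  qed
  have le: "ple x y" if "x \<in> Lo" "y \<in> Hi" for x y
  proof (cases x; cases y)
    fix X Y X' Y' assume "x = (X, Y)" "y = (X', Y')"
    then show ?thesis
      using less[of X Y X' Y'] pairs_ol_imp_ple[OF clq, of X Y "src h" X' Y'] that un by blast
  qed
  obtain x m x' n where *: "(x, m) \<in> Lo" "(x', n) \<in> Hi" "\<And>y. y \<in> Lo \<Longrightarrow> ple y (x, m)"
    "\<And>y. y \<in> Hi \<Longrightarrow> ple (x', n) y" "x = x' \<or> m = n"
    by (rule staircase[OF C un ne le]) blast+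
  have "ol m n" using less * by blast
  then have "x' = x" using * by auto
  then show thesis
    using that[of x m n] * \<open>ol m n\<close> unfolding LoHi by (auto simp del: ple_simp)
qed

text \<open>The staircase at the end of \<open>S\<close> yields two routes of \<open>C\<close> with
  the same initial part \<open>x\<close>, only one of which leaves by an arc after \<open>h\<close>.
  That one still crosses the route of \<open>R'\<close>, so by minimality the segment shared by
  \<open>x\<close> and \<open>Q1 @ f # S\<close> is at least as long as \<open>S\<close>; it is not
  longer, because \<open>x\<close> is at most \<open>P1 @ e # S\<close>.\<close>

lemma shortest_crossing_out:
  assumes C: "mclq C" and R: "P1 @ e # S @ g # P2 \<in> C" and R': "wlk s (Q1 @ f # S @ h # Q2) t"
    and arcs: "ri e f" "ro h g"
    and min: "\<And>X1 e' T g' X2 Y1 f' h' Y2. X1 @ e' # T @ g' # X2 \<in> C \<Longrightarrow>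
      Q1 @ f # S @ h # Q2 = Y1 @ f' # T @ h' # Y2 \<Longrightarrow> ri e' f' \<Longrightarrow> ro h' g' \<Longrightarrow> length S \<le> length T"
  obtains X a m n where "ri a f" "(X @ a # S) @ m \<in> C" "(X @ a # S) @ n \<in> C"
    "ol m n" "\<not> ol [h] m" "ol [h] n"
proof -
  note clq = mclq_clq[OF C]
  have h: "h \<in> E" "src g = src h" using R' ro_src[OF arcs(2)] by (auto simp: walk_append)
  have Rp: "(P1 @ e # S, g # P2) \<in> pairs C (src h)" "ol [h] (g # P2)"
    using pairsI[OF clq, of "P1 @ e # S" "g # P2" "src h"] R clq_walk[OF clq R] h arcs
    by (auto simp: walk_append)
  obtain x m n where st: "(x, m) \<in> pairs C (src h)" "(x, n) \<in> pairs C (src h)" "ol m n"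
    "\<not> ol [h] m" "ol [h] n"
    "\<And>X Y. (X, Y) \<in> pairs C (src h) \<Longrightarrow> ol [h] Y \<Longrightarrow> ple (x, n) (X, Y)"
    by (rule staircase_out[OF C h(1) Rp]) blast
  have x: "x = P1 @ e # S \<or> il x (P1 @ e # S)" using st(6)[OF Rp] by auto
  have "il (P1 @ e # S) (Q1 @ f # S)" using arcs by simp
  then have "il x (Q1 @ f # S)" using x il_trans by blast
  then obtain X a Y b T where X: "x = X @ a # T" "Q1 @ f # S = Y @ b # T" "ri a b"
    using il_iff by blast
  have mem: "x @ m \<in> C" "x @ n \<in> C" using st(1,2) by (auto dest!: pairsD)
  obtain c N where n: "n = c # N" "ro h c" using st(5) by (cases n) auto
  have "X @ a # T @ c # N \<in> C" using mem(2) X n by simp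
  moreover have "Q1 @ f # S @ h # Q2 = Y @ b # T @ h # Q2" using X(2) by (metis append.assoc append_Cons)
  ultimately have len: "length S \<le> length T" using min X(3) n(2) by blast
  from X(2) have "T = S \<and> b = f"
  proof (cases rule: append_Cons_eq_cases)
    case (2 U)
    then show ?thesis using len by simp
  next
    case (3 U)
    then have "x = (X @ a # U) @ f # S" using X by simp
    then have "il (P1 @ e # S) x" using arcs il_Cons_append by metis
    then show ?thesis using x il_asym by auto
  qed simp
  then show thesis using that[of a X m n] X mem st by simp
qed

text \<open>Minimality of \<open>S\<close> is invariant under reversal, so
  \<open>shortest_crossing_out\<close> applies in the reversed graph. The resulting route of
  \<open>C\<close> traverses \<open>S\<close>, leaves it by an arc after \<open>h\<close> and does
  not enter it by an arc before \<open>f\<close>.\<close>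

lemma shortest_crossing_in:
  assumes C: "mclq C" and R: "P1 @ e # S @ g # P2 \<in> C" and R': "wlk s (Q1 @ f # S @ h # Q2) t"
    and arcs: "ri e f" "ro h g"
    and min: "\<And>X1 e' T g' X2 Y1 f' h' Y2. X1 @ e' # T @ g' # X2 \<in> C \<Longrightarrow>
      Q1 @ f # S @ h # Q2 = Y1 @ f' # T @ h' # Y2 \<Longrightarrow> ri e' f' \<Longrightarrow> ro h' g' \<Longrightarrow> length S \<le> length T"
  obtains Y b k where "ro h b" "k @ (S @ b # Y) \<in> C" "\<not> il k [f]"
proof -
  interpret rd: framed_dag E dst src t s "\<lambda>v. - rank v" "\<lambda>e f. ro f e" "\<lambda>e f. ri f e"
    by (rule reversal)
  have mem: "A \<in> rev ` C \<longleftrightarrow> rev A \<in> C" for A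
    by (metis image_iff rev_rev_ident)
  have R1: "rev P2 @ g # rev S @ e # rev P1 \<in> rev ` C" using R by (simp add: mem)
  have R2: "walk E dst src t (rev Q2 @ h # rev S @ f # rev Q1) s" using R' by (simp add: reversal_walk)
  have min': "length (rev S) \<le> length T"
    if 1: "X1 @ e' # T @ g' # X2 \<in> rev ` C" and
      2: "rev Q2 @ h # rev S @ f # rev Q1 = Y1 @ f' # T @ h' # Y2" and 3: "ro f' e'" "ri g' h'"
    for X1 e' T g' X2 Y1 f' h' Y2
  proof -
    have "rev X2 @ g' # rev T @ e' # rev X1 \<in> C" using 1 by (simp add: mem)
    moreover have "rev (rev Q2 @ h # rev S @ f # rev Q1) = rev (Y1 @ f' # T @ h' # Y2)" using 2 by simp
    then have "Q1 @ f # S @ h # Q2 = rev Y2 @ h' # rev T @ f' # rev Y1" by simp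
    ultimately show ?thesis using min 3 by fastforce
  qed
  obtain X a m where *: "ro h a" "(X @ a # rev S) @ m \<in> rev ` C" "\<not> rd.ol [f] m"
    by (rule rd.shortest_crossing_out[OF reversal_mclq[OF C] R1 R2 arcs(2,1) min']) blast
  then show thesis using that[of a "rev m" "rev X"] by (simp add: mem reversal_ol)
qed

lemma prefix_between:
  assumes "S @ a = q \<or> ol (S @ a) q" "q = S @ b \<or> ol q (S @ b)"
  shows "\<exists>c. q = S @ c"
proof (rule ccontr)
  assume neg: "\<not> ?thesis"
  then have "ol S q" using assms(1) ol_append_right_cases by blast
  moreover have "ol q S" using neg assms(2) ol_append_left_cases by blast
  ultimately show False using ol_asym by blast
qed

text \<open>\<open>q\<close> is the largest second coordinate occurring with \<open>p\<close>. Hence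
  the next pair, which exists because of \<open>(k, b)\<close>, has another first coordinate and
  shares \<open>q\<close>, while \<open>(p, q0)\<close> ensures that the preceding pair still has
  first coordinate \<open>p\<close>.\<close>

lemma corner_ex:
  assumes C: "mclq C" and mem: "(p, q0) \<in> pairs C u" "(p, q1) \<in> pairs C u" "ol q0 q1"
    and ex: "(k, b) \<in> pairs C u" "il p k"
  obtains q p' q' where "corner C u p q p' q'" "q1 = q \<or> ol q1 q" "q0 = q' \<or> ol q0 q'" "q = b \<or> ol q b"
proof -
  note clq = mclq_clq[OF C]
  obtain p0 q where "(p0, q) \<in> {x \<in> pairs C u. fst x = p}"
    "\<And>x. x \<in> {x \<in> pairs C u. fst x = p} \<Longrightarrow> ple x (p0, q)"
    by (rule pairs_max[OF clq, of "{x \<in> pairs C u. fst x = p}" u]) (use mem(1) in auto)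
  then have pq: "(p, q) \<in> pairs C u" "\<And>Y. (p, Y) \<in> pairs C u \<Longrightarrow> Y = q \<or> ol Y q"
    by fastforce+
  define Lo Hi Lo' where "Lo = {x \<in> pairs C u. ple x (p, q)}" "Hi = {x \<in> pairs C u. \<not> ple x (p, q)}"
    "Lo' = {x \<in> pairs C u. ple x (p, q) \<and> x \<noteq> (p, q)}"
  note LoHi = this
  have "(p, q) \<in> Lo" using pq LoHi by simp
  have "(k, b) \<in> Hi" using ex il_asym unfolding LoHi by auto
  have Hi: "ple (p, q) x" if "x \<in> Hi" for x using that pairs_total[OF clq pq(1)] unfolding LoHi by blast
  obtain A B p' B' where st: "(A, B) \<in> Lo" "(p', B') \<in> Hi" "\<And>x. x \<in> Lo \<Longrightarrow> ple x (A, B)"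
    "\<And>x. x \<in> Hi \<Longrightarrow> ple (p', B') x" "A = p' \<or> B = B'"
  proof (rule staircase[OF C, of Lo Hi u])
    show "Lo \<union> Hi = pairs C u" unfolding LoHi by blast
    show "ple x y" if "x \<in> Lo" "y \<in> Hi" for x y
      using that Hi ple_trans unfolding LoHi by blast
  qed (use \<open>(p, q) \<in> Lo\<close> \<open>(k, b) \<in> Hi\<close> in blast)+
  have "ple (A, B) (p, q)" "ple (p, q) (A, B)" using st(1,3) \<open>(p, q) \<in> Lo\<close> unfolding LoHi by blast+
  then have AB: "A = p" "B = q" using ple_antisym by blast+
  have "(p, B') \<notin> Hi" using pq(2)[of B'] unfolding LoHi by auto
  then have "p' \<noteq> p" using st(2) by blast
  then have "B' = q" using st(5) AB by blast
  then have p': "(p', q) \<in> Hi" "il p p'" using st(2) \<open>p' \<noteq> p\<close> Hi[of "(p', B')"] by auto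
  have q1: "q1 = q \<or> ol q1 q" "ol q0 q" using pq(2)[OF mem(2)] mem(3) ol_trans by blast+
  then have q0: "(p, q0) \<in> Lo'" using mem(1) unfolding LoHi by auto
  obtain A q' where m: "(A, q') \<in> Lo'" "\<And>x. x \<in> Lo' \<Longrightarrow> ple x (A, q')"
    by (rule pairs_max[OF clq, of Lo' u]) (use q0 in \<open>auto simp: LoHi\<close>)
  have "ple (p, q0) (A, q')" "ple (A, q') (p, q)" "(A, q') \<noteq> (p, q)"
    using m q0 unfolding LoHi by blast+
  then have A: "A = p" "ol q' q" "q0 = q' \<or> ol q0 q'" using il_asym by auto
  have "corner C u p q p' q'"
    unfolding corner_def
  proof (intro conjI ballI)
    fix x assume "x \<in> pairs C u"
    then have "x \<in> Lo' \<or> x = (p, q) \<or> x \<in> Hi" unfolding LoHi by blast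
    moreover have "ple x (p, q')" if "x \<in> Lo'" using m(2)[OF that] A(1) by simp
    moreover have "ple (p', q) x" if "x \<in> Hi" using st(4)[OF that] \<open>B' = q\<close> by simp
    ultimately show "ple x (p, q') \<or> x = (p, q) \<or> ple (p', q) x" by blast
  qed (use pq p' m A LoHi in auto)
  moreover have "q = b \<or> ol q b" using Hi[OF \<open>(k, b) \<in> Hi\<close>] by simp
  ultimately show thesis using that q1 A by blast
qed

lemma cw_exchange_ex:
  assumes C: "mclq C" and C': "mclq C'" and cw: "cwf C C'" and neq: "C \<noteq> C'"
  shows "\<exists>R\<in>C. \<exists>R'. cross R R' \<and> mclq (C - {R} \<union> {R'}) \<and> cwf (C - {R} \<union> {R'}) C'"
proof -
  note clq = mclq_clq[OF C] and clq' = mclq_clq[OF C']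
  define seg where "seg n \<longleftrightarrow> (\<exists>P1 e S g P2 Q1 f h Q2. P1 @ e # S @ g # P2 \<in> C \<and>
    Q1 @ f # S @ h # Q2 \<in> C' \<and> ri e f \<and> ro h g \<and> n = length S)" for n
  have "\<not> cwf C' C" using cwf_antisym[OF C C' cw] neq by blast
  then have "\<exists>n. seg n" unfolding cwf_def cross_iff seg_def by metis
  then have "seg (LEAST n. seg n)" by (rule LeastI_ex)
  then obtain P1 e S g P2 Q1 f h Q2 where R: "P1 @ e # S @ g # P2 \<in> C"
    and R': "Q1 @ f # S @ h # Q2 \<in> C'" and arcs: "ri e f" "ro h g" and len: "(LEAST n. seg n) = length S"
    by (subst (asm) (2) seg_def, elim exE conjE)
  have wR': "wlk s (Q1 @ f # S @ h # Q2) t" using clq_walk[OF clq' R'] .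
  have min: "length S \<le> length T" if "X1 @ e' # T @ g' # X2 \<in> C"
    "Q1 @ f # S @ h # Q2 = Y1 @ f' # T @ h' # Y2" "ri e' f'" "ro h' g'" for X1 e' T g' X2 Y1 f' h' Y2
  proof -
    have "seg (length T)" unfolding seg_def using that R' by metis
    then show ?thesis unfolding len[symmetric] by (rule Least_le)
  qed
  obtain X a m n where out: "ri a f" "(X @ a # S) @ m \<in> C" "(X @ a # S) @ n \<in> C"
    "ol m n" "\<not> ol [h] m" "ol [h] n"
    by (rule shortest_crossing_out[OF C R wR' arcs min]) blast+
  obtain Y b k where inn: "ro h b" "k @ (S @ b # Y) \<in> C" "\<not> il k [f]"
    by (rule shortest_crossing_in[OF C R wR' arcs min]) blast+
  \<comment> \<open>The corner is sought at the first vertex of \<open>S\<close>, where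
    \<open>p\<close> enters by an arc before \<open>f\<close>.\<close>
  define u p where "u = dst f" "p = X @ [a]"
  note up = this
  have wf: "wlk s (Q1 @ [f]) u" "f \<in> E" using wR' up by (auto simp: walk_append)
  have wS: "wlk u S (src h)" using wR' up by (auto simp: walk_append)
  have p_less: "il p (Q1 @ [f])" using out(1) up by simp
  have pm: "(p, S @ m) \<in> pairs C u" "(p, S @ n) \<in> pairs C u"
    using pairsI_il[OF clq, of p "S @ m" "Q1 @ [f]" s u] pairsI_il[OF clq, of p "S @ n" "Q1 @ [f]" s u]
      out(2,3) up p_less wf(1) by auto
  obtain v where v: "wlk s k v" "wlk v (S @ b # Y) t"
    using clq_walk[OF clq inn(2)] unfolding walk_append by blast
  then have "wlk v S (src h)" using ro_src[OF inn(1)] by (auto simp: walk_append)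
  then have "v = u" using walk_start_unique[OF wS] wS by (cases "S = []") auto
  then have kb: "(k, S @ b # Y) \<in> pairs C u" using v inn(2) by (auto simp: pairs_def)
  have "k \<noteq> []" using v(1) \<open>v = u\<close> wf(1) closed_walk_Nil by fastforce
  then obtain k0 c where k: "k = k0 @ [c]" by (metis rev_exhaust)
  have "dst c = dst f" "c \<in> E" using v(1) \<open>v = u\<close> up k by (auto simp: walk_append)
  \<comment> \<open>Since \<open>a\<close> precedes \<open>f\<close>, the walk \<open>k\<close> is
    above \<open>p\<close> and supplies the later pair that \<open>corner_ex\<close> asks
    for.\<close>
  then have "c = f \<or> ri f c" using ri_total[of c f] wf(2) inn(3) k by auto
  then have "ri a c" using out(1) ri_trans by (auto dest: transpD)
  then have pk: "il p k" using up k by simp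
  have lt: "ol (S @ m) (S @ n)" using out(4) by simp
  obtain q p' q' where cor: "corner C u p q p' q'"
    and bounds: "S @ n = q \<or> ol (S @ n) q" "S @ m = q' \<or> ol (S @ m) q'" "q = S @ b # Y \<or> ol q (S @ b # Y)"
    by (rule corner_ex[OF C pm lt kb pk]) blast
  note cd = cornerD[OF cor]
  \<comment> \<open>Both \<open>q\<close> and \<open>q'\<close> lie between walks that begin with
    \<open>S\<close>, so they separate only after \<open>S\<close>.\<close>
  obtain c where q: "q = S @ c" using prefix_between[OF bounds(1,3)] by blast
  obtain c' where q': "q' = S @ c'" using prefix_between[OF bounds(2), of c] cd(5) q by blast
  have "ol c' c" "n = c \<or> ol n c" using cd(5) bounds(1) q q' by auto
  then have hc: "ol [h] c" using out(6) ol_trans by blast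
  obtain P P' e1 e1' S1 where p: "p = P @ e1 # S1" "p' = P' @ e1' # S1" "ri e1 e1'"
    using cd(4) il_iff by blast
  obtain D D' g1 g1' T where c: "c' = T @ g1' # D'" "c = T @ g1 # D" "ro g1' g1"
    using \<open>ol c' c\<close> ol_iff by blast
  have qq': "q = (S @ T) @ g1 # D" "q' = (S @ T) @ g1' # D'" using q q' c by simp_all
  have Rp: "(Q1 @ [f], S @ h # Q2) \<in> pairs C' u" using pairsI[OF clq' _ wf(1)] R' by simp
  have "cwf (C - {p @ q} \<union> {p' @ q'}) C'"
    unfolding p qq'
  proof (rule corner_exchange_cwf[OF C clq' cw _ p(3) c(3) Rp])
    show "corner C u (P @ e1 # S1) ((S @ T) @ g1 # D) (P' @ e1' # S1) ((S @ T) @ g1' # D')"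
      using cor p qq' by simp
    show "il (P @ e1 # S1) (Q1 @ [f])" using p_less p by simp
    have "ol (h # Q2) c" using ol_extend[OF hc, of Q2 "[]"] by simp
    then show "ol (S @ h # Q2) ((S @ T) @ g1 # D)" using c by simp
    \<comment> \<open>The last arc of \<open>e1 # S1\<close> is that of \<open>p\<close>, namely
      \<open>a\<close>, which differs from \<open>f\<close>.\<close>
    show "\<nexists>X. Q1 @ [f] = X @ e1 # S1"
    proof
      assume "\<exists>X. Q1 @ [f] = X @ e1 # S1"
      then have "f = last (e1 # S1)" by (metis last_appendR last_snoc list.discI)
      moreover have "a = last (e1 # S1)" using p(1) up by (metis last_appendR last_snoc list.discI)
      ultimately show False using out(1) by simp
    qed
    \<comment> \<open>\<open>c\<close> starts with an arc after \<open>h\<close>, so no walk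
      starting with \<open>h\<close> begins with \<open>T @ [g1]\<close>.\<close>
    show "\<nexists>Y. S @ h # Q2 = (S @ T) @ g1 # Y"
      using hc c(2) by (cases T) auto
  qed
  moreover have "cross (p @ q) (p' @ q')" using crossI cd(4,5) by blast
  moreover have "p @ q \<in> C" using cd(1) by (auto dest!: pairsD)
  ultimately show ?thesis using corner_exchange[OF C cor] by blast
qed

section \<open>Chains of exchanges\<close>

definition exchange :: "'e list set \<Rightarrow> 'e list set \<Rightarrow> bool" where
  "exchange C D \<longleftrightarrow> mclq C \<and> mclq D \<and> (\<exists>R\<in>C. \<exists>R'. D = C - {R} \<union> {R'} \<and> cross R R')"

lemma exchange_imp_cwf: "exchange C D \<Longrightarrow> cwf C D"
  unfolding exchange_def using exchange_cwf by blast

lemma cwf_refl: "mclq C \<Longrightarrow> cwf C C"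
  unfolding cwf_def using clqD mclq_clq by blast

lemma finite_mclqs: "finite {C. mclq C}"
proof (rule finite_subset)
  show "{C. mclq C} \<subseteq> Pow {R. wlk s R t}" using clq_walk mclq_clq by blast
  show "finite (Pow {R. wlk s R t})" using finite_walks by blast
qed

theorem exchange_rtranclp_iff_cwf:
  assumes "mclq C" "mclq C'"
  shows "exchange\<^sup>*\<^sup>* C C' \<longleftrightarrow> cwf C C'"
proof
  assume "exchange\<^sup>*\<^sup>* C C'"
  then show "cwf C C'"
  proof (induction rule: rtranclp_induct)
    case base
    show ?case using cwf_refl assms by blast
  next
    case (step D D')
    then have "clq C" "mclq D" "clq D'" using assms mclq_clq unfolding exchange_def by blast+
    then show ?case using cwf_trans step exchange_imp_cwf by blast
  qed
next
  assume "cwf C C'"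
  with assms(1) show "exchange\<^sup>*\<^sup>* C C'"
  \<comment> \<open>The measure counts the maximal cliques that \<open>C\<close> is clockwise from;
    it drops with each exchange.\<close>
  proof (induction "card {D. mclq D \<and> cwf C D}" arbitrary: C rule: less_induct)
    case less
    show ?case
    proof (cases "C = C'")
      case False
      obtain R R' where R: "R \<in> C" "cross R R'" and D: "mclq (C - {R} \<union> {R'})" "cwf (C - {R} \<union> {R'}) C'"
        using cw_exchange_ex[OF less.prems(1) assms(2) less.prems(2) False] by blast
      define D where "D = C - {R} \<union> {R'}"
      have ex: "exchange C D" using R D less.prems unfolding exchange_def D_def by blast
      then have cw: "cwf C D" and mD: "mclq D" using exchange_imp_cwf exchange_def by auto
      \<comment> \<open>\<open>R\<close> crosses \<open>R'\<close> but not itself, so the exchange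
        really loses \<open>R\<close>; antisymmetry then makes the inclusion of the counted sets
        strict.\<close>
      have "R \<notin> D" using R no_self_cross clq_walk mclq_clq less.prems(1) unfolding D_def by blast
      then have "\<not> cwf D C" using cwf_antisym[OF less.prems(1) mD cw] R by blast
      moreover have "{B. mclq B \<and> cwf D B} \<subseteq> {B. mclq B \<and> cwf C B}"
        using cwf_trans cw mD mclq_clq less.prems(1) by blast
      ultimately have "{B. mclq B \<and> cwf D B} \<subset> {B. mclq B \<and> cwf C B}"
        using cwf_refl less.prems(1) by blast
      moreover have "finite {B. mclq B \<and> cwf C B}"
        by (rule finite_subset[OF _ finite_mclqs]) blast
      ultimately have "card {B. mclq B \<and> cwf D B} < card {B. mclq B \<and> cwf C B}"
        by (rule psubset_card_mono[rotated])
      then have "exchange\<^sup>*\<^sup>* D C'" using less.hyps mD D unfolding D_def by blast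
      then show ?thesis using ex by (rule converse_rtranclp_into_rtranclp[rotated])
    qed simp
  qed
qed

end

section \<open>Framed graphs\<close>

context framed_graph
begin

text \<open>Vertices come from an arbitrary linear order; counting smaller vertices of the finite
  graph provides the integer rank.\<close>

definition height :: "'v \<Rightarrow> int" where
  "height v = int (card {x \<in> verts G. x < v})"

definition in_lt :: "'e \<Rightarrow> 'e \<Rightarrow> bool" where
  "in_lt e f \<longleftrightarrow> e \<in> arcs G \<and> f \<in> arcs G \<and> e \<noteq> f \<and> head G e = head G f \<and> (e, f) \<in> in_ord F (head G e)"

definition out_lt :: "'e \<Rightarrow> 'e \<Rightarrow> bool" where
  "out_lt e f \<longleftrightarrow> e \<in> arcs G \<and> f \<in> arcs G \<and> e \<noteq> f \<and> tail G e = tail G f \<and> (e, f) \<in> out_ord F (tail G e)"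

lemma walk_iff: "u \<in> verts G \<Longrightarrow> walk (arcs G) (tail G) (head G) u p v \<longleftrightarrow> awalk u p v"
  by (induction p arbitrary: u) (auto simp: awalk_Nil_iff awalk_Cons_iff)

lemma source_sink: "s \<in> verts G" "t \<in> verts G"
  using unique_source unique_sink by blast+

text \<open>This makes the distinctness condition on paths automatic, so that routes are just the
  walks from \<open>s\<close> to \<open>t\<close>.\<close>

lemma awalk_verts_increasing:
  "awalk u p v \<Longrightarrow> (\<forall>x\<in>set (awalk_verts u p). u \<le> x) \<and> distinct (awalk_verts u p)"
proof (induction p arbitrary: u)
  case (Cons e p)
  then have "e \<in> arcs G" "u = tail G e" "awalk (head G e) p v" by (auto simp: awalk_Cons_iff)
  moreover have "tail G e < head G e" using arcs_increasing calculation by blast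
  ultimately show ?case using Cons.IH[of "head G e"] by fastforce
qed auto

lemma routes_iff: "R \<in> routes G s t \<longleftrightarrow> walk (arcs G) (tail G) (head G) s R t"
  using awalk_verts_increasing[of s R t] walk_iff[OF source_sink(1)]
  by (auto simp: routes_def apath_def)

lemma height_less: "v \<in> verts G \<Longrightarrow> v < w \<Longrightarrow> height v < height w"
  unfolding height_def by (auto intro!: psubset_card_mono)

lemma walk_from_source: "v \<in> verts G \<Longrightarrow> \<exists>A. walk (arcs G) (tail G) (head G) s A v"
proof (induction "card {x \<in> verts G. x < v}" arbitrary: v rule: less_induct)
  case less
  show ?case
  proof (cases "v = s")
    case False
    then obtain e where e: "e \<in> arcs G" "head G e = v"
      using unique_source less.prems by (auto simp: in_arcs_def)
    then have "tail G e \<in> verts G" "tail G e < v" using arcs_increasing by auto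
    then obtain A where "walk (arcs G) (tail G) (head G) s A (tail G e)"
      using less.hyps[of "tail G e"] height_less[of "tail G e" v] unfolding height_def by auto
    then show ?thesis using e by (intro exI[of _ "A @ [e]"]) (auto simp: walk_append)
  qed (auto intro: exI[of _ "[]"])
qed

lemma walk_to_sink: "v \<in> verts G \<Longrightarrow> \<exists>A. walk (arcs G) (tail G) (head G) v A t"
proof (induction "card {x \<in> verts G. v < x}" arbitrary: v rule: less_induct)
  case less
  show ?case
  proof (cases "v = t")
    case False
    then obtain e where e: "e \<in> arcs G" "tail G e = v"
      using unique_sink less.prems by (auto simp: out_arcs_def)
    then have "head G e \<in> verts G" "v < head G e" using arcs_increasing by auto
    then have "card {x \<in> verts G. head G e < x} < card {x \<in> verts G. v < x}"
      by (auto intro!: psubset_card_mono)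
    then obtain A where "walk (arcs G) (tail G) (head G) (head G e) A t"
      using less.hyps[of "head G e"] \<open>head G e \<in> verts G\<close> by auto
    then show ?thesis using e by (intro exI[of _ "e # A"]) auto
  qed (auto intro: exI[of _ "[]"])
qed

lemma framed_dag: "framed_dag (arcs G) (tail G) (head G) s t height in_lt out_lt"
proof
  show "finite (arcs G)" by simp
  show "\<exists>R. walk (arcs G) (tail G) (head G) s R t" using walk_from_source source_sink by blast
  show "irreflp in_lt" "irreflp out_lt" by (auto simp: irreflp_def in_lt_def out_lt_def)
  fix e assume e: "e \<in> arcs G"
  then show "height (tail G e) < height (head G e)" using height_less arcs_increasing by auto
  show "\<exists>A B. walk (arcs G) (tail G) (head G) s (A @ e # B) t"
    using walk_from_source[of "tail G e"] walk_to_sink[of "head G e"] e by (auto simp: walk_append)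
next
  show "transp in_lt"
  proof (rule transpI)
    fix e f g assume *: "in_lt e f" "in_lt f g"
    have "head G e \<in> verts G" using * unfolding in_lt_def by auto
    then show "in_lt e g" using * in_ord_linear[of "head G e"] unfolding in_lt_def
        linear_order_on_def partial_order_on_def preorder_on_def by (metis antisymD transD)
  qed
  show "transp out_lt"
  proof (rule transpI)
    fix e f g assume *: "out_lt e f" "out_lt f g"
    have "tail G e \<in> verts G" using * unfolding out_lt_def by auto
    then show "out_lt e g" using * out_ord_linear[of "tail G e"] unfolding out_lt_def
        linear_order_on_def partial_order_on_def preorder_on_def by (metis antisymD transD)
  qed
  fix e f assume ef: "e \<in> arcs G" "f \<in> arcs G" "e \<noteq> f"
  show "in_lt e f \<or> in_lt f e" if "head G e = head G f"
    using in_ord_linear[of "head G e"] ef that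
    unfolding linear_order_on_def total_on_def in_lt_def by auto
  show "out_lt e f \<or> out_lt f e" if "tail G e = tail G f"
    using out_ord_linear[of "tail G e"] ef that
    unfolding linear_order_on_def total_on_def out_lt_def by auto
qed (auto simp: in_lt_def out_lt_def)

sublocale fd: framed_dag "arcs G" "tail G" "head G" s t height in_lt out_lt
  by (rule framed_dag)

section \<open>Crossings as clockwise comparisons at a vertex\<close>

lemma in_less_imp_il:
  "in_less G F A B \<Longrightarrow> set A \<subseteq> arcs G \<Longrightarrow> set B \<subseteq> arcs G \<Longrightarrow> fd.il A B"
  unfolding in_less_def fd.il_iff in_lt_def by fastforce

lemma out_less_imp_ol:
  "out_less G F A B \<Longrightarrow> set A \<subseteq> arcs G \<Longrightarrow> set B \<subseteq> arcs G \<Longrightarrow> fd.ol A B"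
  unfolding out_less_def fd.ol_iff out_lt_def by fastforce

lemma path_split: "path_to G P v @ path_from G v P = P"
  by (simp add: path_to_def path_from_def)

lemma set_path_parts: "set (path_to G P v) \<subseteq> set P" "set (path_from G v P) \<subseteq> set P"
  by (auto simp: path_to_def path_from_def dest: set_takeWhileD set_dropWhileD)

text \<open>By acyclicity no arc of \<open>A\<close> leaves \<open>v\<close>, while the first arc of
  the nonempty \<open>B\<close> does, so \<open>takeWhile\<close> stops exactly there.\<close>

lemma path_parts_eq:
  assumes "fd.wlk s (A @ B) t" "fd.wlk s A v" "B \<noteq> []"
  shows "path_to G (A @ B) v = A \<and> path_from G v (A @ B) = B"
proof -
  have "tail G e \<noteq> v" if e: "e \<in> set A" for e
  proof -
    obtain X Y where "A = X @ e # Y" using split_list[OF e] by blast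
    then have "fd.wlk (tail G e) (e # Y) v" using assms(2) by (auto simp: walk_append)
    then show ?thesis using fd.closed_walk_Nil by blast
  qed
  moreover have "tail G (hd B) = v"
    using assms by (cases B) (auto simp: walk_append dest: walk_end_unique)
  ultimately show ?thesis
    using assms(3) unfolding path_to_def path_from_def by (cases B) auto
qed

lemma inner_vertI:
  assumes "fd.wlk s (A @ B) t" "fd.wlk s A v" "A \<noteq> []" "B \<noteq> []"
  shows "v \<in> inner_verts G (A @ B)"
proof -
  have wB: "fd.wlk v B t" using assms by (auto simp: walk_append dest: walk_end_unique)
  then have "v \<in> tail G ` set (A @ B)" using assms(4) by (cases B) auto
  moreover have "tail G (hd (A @ B)) = s" using assms(1,3) by (cases A) auto
  moreover have "head G (last (A @ B)) = t" using assms(1,4)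
    by (cases B rule: rev_cases) (auto simp: walk_append)
  moreover have "v \<noteq> s" "v \<noteq> t" using fd.closed_walk_Nil assms wB by blast+
  ultimately show ?thesis unfolding inner_verts_def by auto
qed

lemma cw_less_parts:
  assumes "cw_less G F v P Q" "P \<in> routes G s t" "Q \<in> routes G s t"
  shows "fd.il (path_to G P v) (path_to G Q v)" "fd.ol (path_from G v Q) (path_from G v P)"
proof -
  note arcs = walk_arcs[OF assms(2)[unfolded routes_iff]] walk_arcs[OF assms(3)[unfolded routes_iff]]
  show "fd.il (path_to G P v) (path_to G Q v)"
    using assms(1) arcs set_path_parts(1)[of P v] set_path_parts(1)[of Q v] unfolding cw_less_def
    by (intro in_less_imp_il) auto
  show "fd.ol (path_from G v Q) (path_from G v P)"
    using assms(1) arcs set_path_parts(2)[of v P] set_path_parts(2)[of v Q] unfolding cw_less_def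
    by (intro out_less_imp_ol) auto
qed

text \<open>A crossing has a common segment with distinct entering and leaving arcs. Its first
  vertex can serve as \<open>v\<close>, and the arcs on both sides make it an inner vertex of both
  routes.\<close>

lemma cross_iff_cw_less:
  assumes P: "P \<in> routes G s t" and Q: "Q \<in> routes G s t"
  shows "fd.cross P Q \<longleftrightarrow> (\<exists>v. cw_less G F v P Q)"
proof
  assume "\<exists>v. cw_less G F v P Q"
  then obtain v where v: "cw_less G F v P Q" by blast
  show "fd.cross P Q"
    using fd.crossI[OF cw_less_parts[OF v P Q]] by (simp add: path_split)
next
  assume "fd.cross P Q"
  then obtain P1 e S g P2 Q1 f h Q2 where *: "P = P1 @ e # S @ g # P2" "Q = Q1 @ f # S @ h # Q2"
    "in_lt e f" "out_lt h g" unfolding fd.cross_iff by blast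
  define A B A' B' v where "A = P1 @ [e]" "B = S @ g # P2" "A' = Q1 @ [f]" "B' = S @ h # Q2" "v = head G e"
  note defs = this
  have PQ: "P = A @ B" "Q = A' @ B'" "A \<noteq> []" "B \<noteq> []" "A' \<noteq> []" "B' \<noteq> []" using * defs by auto
  have w: "fd.wlk s (A @ B) t" "fd.wlk s (A' @ B') t" using P Q PQ routes_iff by auto
  then have v: "fd.wlk s A v" "fd.wlk s A' v" using defs *(3) in_lt_def by (auto simp: walk_append)
  note parts = path_parts_eq[OF w(1) v(1)] path_parts_eq[OF w(2) v(2)]
  have "in_less G F A A'"
    using *(3) defs unfolding in_less_def in_lt_def
    by (metis append_Cons append_Nil)
  moreover have "out_less G F B' B"
    using *(4) defs unfolding out_less_def out_lt_def by metis
  moreover have "v \<in> inner_verts G P \<inter> inner_verts G Q" using inner_vertI w v PQ by auto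
  ultimately have "cw_less G F v P Q" unfolding cw_less_def using parts PQ by auto
  then show "\<exists>v. cw_less G F v P Q" by blast
qed

lemma coherent_iff:
  assumes "P \<in> routes G s t" "Q \<in> routes G s t"
  shows "coherent G F P Q \<longleftrightarrow> \<not> fd.cross P Q \<and> \<not> fd.cross Q P"
  unfolding cross_iff_cw_less[OF assms] cross_iff_cw_less[OF assms(2,1)]
  unfolding coherent_def incoherent_at_def by (auto simp: cw_less_def)

lemma clique_iff: "clique G s t F C \<longleftrightarrow> fd.clq C"
  using coherent_iff unfolding clique_def fd.clq_def subset_iff routes_iff by blast

lemma maximal_cliques_iff: "C \<in> maximal_cliques G s t F \<longleftrightarrow> fd.mclq C"
proof
  assume C: "C \<in> maximal_cliques G s t F"
  then have clq: "fd.clq C" and max: "\<And>D. fd.clq D \<Longrightarrow> C \<subseteq> D \<Longrightarrow> D = C"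
    unfolding maximal_cliques_def clique_iff by blast+
  have "R \<in> C" if R: "fd.wlk s R t" "\<forall>Z\<in>C. \<not> fd.cross R Z \<and> \<not> fd.cross Z R" for R
  proof -
    have "fd.clq (insert R C)" using clq R fd.no_self_cross unfolding fd.clq_def by blast
    then show ?thesis using max by blast
  qed
  then show "fd.mclq C" using clq unfolding fd.mclq_def by blast
next
  assume C: "fd.mclq C"
  have "D = C" if "fd.clq D" "C \<subseteq> D" for D
    using fd.mclqI_mem[OF C fd.clq_walk[OF that(1)]] fd.clqD[OF that(1)] that(2) by blast
  then show "C \<in> maximal_cliques G s t F"
    using fd.mclq_clq[OF C] unfolding maximal_cliques_def clique_iff by blast
qed

lemma cw_from_iff:
  assumes "C \<subseteq> routes G s t" "C' \<subseteq> routes G s t"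
  shows "cw_from G F C C' \<longleftrightarrow> fd.cwf C C'"
proof -
  have "(\<forall>v\<in>inner_verts G R \<inter> inner_verts G R'. \<not> incoherent_at G F v R R' \<or> cw_less G F v R R')
    \<longleftrightarrow> \<not> fd.cross R' R" if R: "R \<in> C" "R' \<in> C'" for R R'
  proof -
    have rt: "R \<in> routes G s t" "R' \<in> routes G s t" using R assms by auto
    have "\<not> cw_less G F v R' R" if "cw_less G F v R R'" for v
      using cw_less_parts(1)[OF that rt] cw_less_parts(1)[of v R' R] rt fd.il_asym by blast
    then show ?thesis
      unfolding cross_iff_cw_less[OF rt(2,1)] incoherent_at_def by (auto simp: cw_less_def)
  qed
  then show ?thesis unfolding cw_from_def fd.cwf_def by blast
qed

lemma framing_step_iff: "framing_step G s t F C D \<longleftrightarrow> fd.exchange C D"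
proof -
  have "fd.cross R R' \<longleftrightarrow> (\<exists>u. cw_less G F u R R')"
    if "fd.mclq C" "fd.mclq (C - {R} \<union> {R'})" "R \<in> C" for R R'
    using that fd.clq_walk fd.mclq_clq by (intro cross_iff_cw_less) (auto simp: routes_iff)
  then show ?thesis
    unfolding framing_step_def fd.exchange_def maximal_cliques_iff by blast
qed

end

theorem theorem2p15:
  fixes G :: "('v::linorder, 'e) pre_digraph" and s t :: 'v and F :: "('v, 'e) framing"
    and C C' :: "'e list set"
  assumes "framed_graph G s t F"
    and "C \<in> maximal_cliques G s t F"
    and "C' \<in> maximal_cliques G s t F"
  shows "framing_le G s t F C C' \<longleftrightarrow> cw_from G F C C'"
proof -
  interpret framed_graph G s t F by fact
  have m: "fd.mclq C" "fd.mclq C'" using assms(2,3) maximal_cliques_iff by auto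
  then have "C \<subseteq> routes G s t" "C' \<subseteq> routes G s t"
    using fd.clq_walk fd.mclq_clq routes_iff by blast+
  then have "cw_from G F C C' \<longleftrightarrow> fd.exchange\<^sup>*\<^sup>* C C'"
    using cw_from_iff fd.exchange_rtranclp_iff_cwf[OF m] by simp
  moreover have "framing_step G s t F = fd.exchange" using framing_step_iff by blast
  ultimately show ?thesis using assms(2,3) unfolding framing_le_def by simp
qed

end
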